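(* Let $(p,q)\in\{(2,2),(2,\infty),(\infty,\infty)\}$ and suppose the system $$x(t+1)=Ax(t)+Bw(t),\quad x(0)=0,\qquad y(t)=Cx(t)+Dw(t)+a(t),\qquad t\in\mathbb Z_+,$$ is $2\rho$-detectable. Let $\hat x$ be the estimate produced by the proposed estimator (defined in the context) and $e=x-\hat x$. Then the estimator has a bounded estimation error. In particular, the worst-case estimation error $$\sup_{\|w\|_p\le1,\ \|a\|_0\le\rho}\|e\|_q$$ (the norm being that of the whole sequence $e=\{e(t)\}_{t\in\mathbb Z_+}$) is upper-bounded by $$\begin{cases} \displaystyle\max_{\mathcal I\in\mathcal V}\|E^{\mathcal I}(K^{\mathcal I})\|_{2\to2}+\max_{\mathcal I,\mathcal J\in\mathcal V}\sqrt{\tfrac12\log|\mathcal V|}\;\mathcal D^{\mathcal I,\mathcal J}_{2,2}&\text{if }(p,q)=(2,2),\\[2mm] \displaystyle\max_{\mathcal I,\mathcal J\in\mathcal V}\Big(\|E^{\mathcal I}(K^{\mathcal I})\|_{2\to\infty}+\tfrac12\mathcal D^{\mathcal I,\mathcal J}_{2,\infty}\Big)&\text{if }(p,q)=(2,\infty),\\[2mm] \displaystyle\max_{\mathcal I,\mathcal J\in\mathcal V}\Big(\|E^{\mathcal I}(K^{\mathcal I})\|_{\infty\to\infty}+\tfrac12\mathcal D^{\mathcal I,\mathcal J}_{\infty,\infty}\Big)&\text{if }(p,q)=(\infty,\infty). \end{cases}$$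
   Context: System. $x(t)\in\mathbb R^n$ is the state, $w(t)\in\mathbb R^l$ the disturbance, $y(t)\in\mathbb R^m$ the measurement, $a(t)\in\mathbb R^m$ the attack; $A,B,C,D$ are real matrices of compatible sizes and $B$ has full row rank. Sensors are indexed by $\mathcal S=\{1,\dots,m\}$; $\rho$ is a non-negative integer. Norms. $\|x\|_0=|\{i:\exists t,\ x_i(t)\ne0\}|$, $\|x\|_\infty=\sup_t\max_i|x_i(t)|$, $\|x\|_2=(\sum_t\sum_i|x_i(t)|^2)^{1/2}$; $x(0:T)$ is the truncation of $x$ to times $0,\dots,T$, with norms defined by restricting the sup/sum to these times. The block matrix $\left[\begin{array}{c|c}A&B\\\hline C&D\end{array}\right]$ denotes the LTI system $x(t+1)=Ax(t)+Bw(t)$, $y(t)=Cx(t)+Dw(t)$, $x(0)=0$; for such a system $G$, $\|G\|_{p\to q}=\sup_{0<\|w\|_p<\infty}\|y\|_q/\|w\|_p$. For a matrix $M$, $\|M\|_{p\to p}=\sup_{v\neq0}\|Mv\|_p/\|v\|_p$. Detectability. A square matrix is strictly stable if all its eigenvalues lie in the open unit disc; $(A,C)$ is detectable if $A+KC$ is strictly stable for some $K$. For an index set $\mathcal I=\{i_1,\dots,i_{m'}\}\subseteq\mathcal S$, $P_{\mathcal I}\in\mathbb R^{m'\times m}$ is the matrix with rows $e_{i_1}^T,\dots,e_{i_{m'}}^T$ (canonical basis vectors), and $y_{\mathcal I}=P_{\mathcal I}y$, $C_{\mathcal I}=P_{\mathcal I}C$, $D_{\mathcal I}=P_{\mathcal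 I}D$. The system is $\chi$-detectable if $(A,C_{\mathcal K})$ is detectable for every $\mathcal K\subseteq\mathcal S$ with $|\mathcal K|=m-\chi$. The proposed estimator. Let $\mathcal V=\{\mathcal I\subseteq\mathcal S:|\mathcal I|=m-\rho\}$. For each $\mathcal I\in\mathcal V$ fix a matrix $K^{\mathcal I}\in\mathbb R^{n\times(m-\rho)}$ with $A+K^{\mathcal I}C_{\mathcal I}$ strictly stable. The local estimator $\mathcal I$ is $$\hat x^{\mathcal I}(t+1)=A\hat x^{\mathcal I}(t)-K^{\mathcal I}\big(y_{\mathcal I}(t)-C_{\mathcal I}\hat x^{\mathcal I}(t)\big),\quad \hat x^{\mathcal I}(0)=0,$$ with residual $r^{\mathcal I}(t)=y_{\mathcal I}(t)-C_{\mathcal I}\hat x^{\mathcal I}(t)$. Put $$E^{\mathcal I}(K^{\mathcal I})=\left[\begin{array}{c|c}A+K^{\mathcal I}C_{\mathcal I}&B+K^{\mathcal I}D_{\mathcal I}\\\hline I&0\end{array}\right],\qquad F^{\mathcal I}(K^{\mathcal I})=\left[\begin{array}{c|c}A+K^{\mathcal I}C_{\mathcal I}&B+K^{\mathcal I}D_{\mathcal I}\\\hline C_{\mathcal I}&D_{\mathcal I}\end{array}\right].$$ The set of valid local estimators at time $t$ is $\mathcal V(t)=\{\mathcal I\in\mathcal V:\|r^{\mathcal I}(0:t)\|_q\le\|F^{\mathcal I}(K^{\mathcal I})\|_{p\to q}\}$. The global estimate $\hat x(t)$ has components $$\hat x_i(t)=\tfrac12\Big(\min_{\mathcal I\in\mathcal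 V(t)}\hat x_i^{\mathcal I}(t)+\max_{\mathcal J\in\mathcal V(t)}\hat x_i^{\mathcal J}(t)\Big)\ \text{if }q=\infty,\qquad \hat x_i(t)=\frac1{|\mathcal V(t)|}\sum_{\mathcal I\in\mathcal V(t)}\hat x_i^{\mathcal I}(t)\ \text{if }q=2 .$$ The quantity $\mathcal D$. For $\mathcal I,\mathcal J\in\mathcal V$, $$\mathcal D^{\mathcal I,\mathcal J}_{p,q}=\alpha^{\mathcal I\cap\mathcal J}_{p,q}\big(\beta^{\mathcal I,\mathcal I\cap\mathcal J}_{p,q}+\beta^{\mathcal J,\mathcal I\cap\mathcal J}_{p,q}\big),$$ $$\alpha^{\mathcal K}_{p,q}=\inf_{K:\,A+KC_{\mathcal K}\text{ strictly stable}}\left\|\left[\begin{array}{c|c}A+KC_{\mathcal K}&\begin{bmatrix}I&K\end{bmatrix}\\\hline I&0\end{array}\right]\right\|_{p\to q},\qquad \beta^{\mathcal I,\mathcal K}_{p,q}=\left\|\begin{bmatrix}-K^{\mathcal I}\\P_{\mathcal K,\mathcal I}\end{bmatrix}\right\|_{p\to p}\|r^{\mathcal I}(0:T)\|_p,$$ where for $\mathcal K\subseteq\mathcal I$, $P_{\mathcal K,\mathcal I}\in\mathbb R^{|\mathcal K|\times|\mathcal I|}$ is the unique solution of $P_{\mathcal K}=P_{\mathcal K,\mathcal I}P_{\mathcal I}$. Here $T$ is a time at which the local estimator $\mathcal I$ is valid, and $\mathcal D^{\mathcal I,\mathcal J}_{p,q}$ is a single number, not varying with $T$, $w$ or $a$: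 the factor $\|r^{\mathcal I}(0:T)\|_p$ is understood as its supremum over all $w,a$ with $\|w\|_p\le1$, $\|a\|_0\le\rho$ and all $T\in\mathbb Z_+$ with $\mathcal I\in\mathcal V(T)$. $\log$ is the natural logarithm. *)

theory Defs
  imports
    "HOL-Library.Extended_Nonnegative_Real"
    "Jordan_Normal_Form.Char_Poly"
    "Jordan_Normal_Form.DL_Rank"
begin

text \<open>
  Vectors and matrices are those of \<open>Jordan_Normal_Form\<close>, whose dimensions are natural numbers
  fixed by carrier conditions. Indices start at 0, so the sensor set is \<open>{0..<m}\<close>.
  Norms of sequences, system gains and everything built from them are \<open>ennreal\<close>-valued, since
  they may be infinite a priori.
\<close>

section \<open>Signals and norms\<close>

datatype lp = L2 | Linf

type_synonym signal = "nat \<Rightarrow> real vec"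

definition signals :: "nat \<Rightarrow> signal set" where
  "signals d = {x. \<forall>t. x t \<in> carrier_vec d}"

fun vnorm :: "lp \<Rightarrow> real vec \<Rightarrow> real" where
  "vnorm L2 v = sqrt (\<Sum>i<dim_vec v. (v $ i)\<^sup>2)"
| "vnorm Linf v = Max (insert 0 ((\<lambda>i. \<bar>v $ i\<bar>) ` {..<dim_vec v}))"

fun signal_norm :: "lp \<Rightarrow> signal \<Rightarrow> ennreal" where
  "signal_norm L2 x =
     (if summable (\<lambda>t. \<Sum>i<dim_vec (x t). (x t $ i)\<^sup>2)
      then ennreal (sqrt (\<Sum>t. \<Sum>i<dim_vec (x t). (x t $ i)\<^sup>2)) else \<infinity>)"
| "signal_norm Linf x = (SUP t. ennreal (vnorm Linf (x t)))"

text \<open>The norm of the truncation of \<open>x\<close> to the times \<open>0, \<dots>, T\<close>.\<close>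

fun trunc_norm :: "lp \<Rightarrow> nat \<Rightarrow> signal \<Rightarrow> ennreal" where
  "trunc_norm L2 T x = ennreal (sqrt (\<Sum>t\<le>T. \<Sum>i<dim_vec (x t). (x t $ i)\<^sup>2))"
| "trunc_norm Linf T x = (SUP t\<in>{..T}. ennreal (vnorm Linf (x t)))"

text \<open>The norm \<open>\<parallel>x\<parallel>\<^sub>0\<close>: the number of components that are not identically zero in time.\<close>

definition supp_size :: "signal \<Rightarrow> nat" where
  "supp_size x = card {i. \<exists>t. i < dim_vec (x t) \<and> x t $ i \<noteq> 0}"

definition mat_norm :: "lp \<Rightarrow> real mat \<Rightarrow> ennreal" where
  "mat_norm p M = (SUP v\<in>carrier_vec (dim_col M) - {0\<^sub>v (dim_col M)}.
     ennreal (vnorm p (M *\<^sub>v v) / vnorm p v))"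

section \<open>Linear time-invariant systems\<close>

text \<open>\<open>LTI A B C D\<close> is the block matrix with rows \<open>(A | B)\<close> and \<open>(C | D)\<close>.\<close>

datatype lti = LTI (matA: "real mat") (matB: "real mat") (matC: "real mat") (matD: "real mat")

abbreviation state_dim :: "lti \<Rightarrow> nat" where "state_dim G \<equiv> dim_row (matA G)"
abbreviation input_dim :: "lti \<Rightarrow> nat" where "input_dim G \<equiv> dim_col (matB G)"
abbreviation output_dim :: "lti \<Rightarrow> nat" where "output_dim G \<equiv> dim_row (matC G)"

primrec lti_state :: "lti \<Rightarrow> signal \<Rightarrow> signal" where
  "lti_state G w 0 = 0\<^sub>v (state_dim G)"
| "lti_state G w (Suc t) = matA G *\<^sub>v lti_state G w t + matB G *\<^sub>v w t"

definition lti_output :: "lti \<Rightarrow> signal \<Rightarrow> signal" where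
  "lti_output G w t = matC G *\<^sub>v lti_state G w t + matD G *\<^sub>v w t"

definition gain :: "lp \<Rightarrow> lp \<Rightarrow> lti \<Rightarrow> ennreal" where
  "gain p q G =
     (SUP w\<in>{w \<in> signals (input_dim G). 0 < signal_norm p w \<and> signal_norm p w < \<infinity>}.
        signal_norm q (lti_output G w) / signal_norm p w)"

section \<open>Detectability\<close>

definition strictly_stable :: "real mat \<Rightarrow> bool" where
  "strictly_stable M \<longleftrightarrow> (\<forall>z. eigenvalue (map_mat complex_of_real M) z \<longrightarrow> cmod z < 1)"

definition detectable :: "real mat \<Rightarrow> real mat \<Rightarrow> bool" where
  "detectable A C \<longleftrightarrow> (\<exists>K\<in>carrier_mat (dim_row A) (dim_row C). strictly_stable (A + K * C))"

text \<open>The selection matrix with rows \<open>e\<^sub>i\<^sup>T\<close>, for \<open>i \<in> I\<close> in increasing order.\<close>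

definition sel :: "nat \<Rightarrow> nat set \<Rightarrow> real mat" where
  "sel m I = mat_of_rows m (map (unit_vec m) (sorted_list_of_set I))"

text \<open>\<open>resel m J I\<close> is the solution \<open>Q\<close> of \<open>P\<^sub>J = Q P\<^sub>I\<close>, which is unique for \<open>J \<subseteq> I\<close>.\<close>

definition resel :: "nat \<Rightarrow> nat set \<Rightarrow> nat set \<Rightarrow> real mat" where
  "resel m J I = (THE Q. Q \<in> carrier_mat (card J) (card I) \<and> sel m J = Q * sel m I)"

definition selC :: "lti \<Rightarrow> nat set \<Rightarrow> real mat" where
  "selC G I = sel (output_dim G) I * matC G"

definition selD :: "lti \<Rightarrow> nat set \<Rightarrow> real mat" where
  "selD G I = sel (output_dim G) I * matD G"

text \<open>
  The subtraction is that of the natural numbers: for \<open>\<chi> > m\<close> the condition is detectability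
  from the empty set of sensors, i.e. strict stability of \<open>A\<close>, and not vacuous.
\<close>

definition chi_detectable :: "nat \<Rightarrow> lti \<Rightarrow> bool" where
  "chi_detectable \<chi> G \<longleftrightarrow>
     (\<forall>J\<subseteq>{0..<output_dim G}. card J = output_dim G - \<chi> \<longrightarrow> detectable (matA G) (selC G J))"

section \<open>The estimator\<close>

definition sensor_sets :: "nat \<Rightarrow> nat \<Rightarrow> nat set set" where
  "sensor_sets m \<rho> = {I. I \<subseteq> {0..<m} \<and> card I = m - \<rho>}"

definition measurement :: "lti \<Rightarrow> signal \<Rightarrow> signal \<Rightarrow> signal" where
  "measurement G w a t = lti_output G w t + a t"

text \<open>\<open>K I\<close> is the observer gain of the local estimator \<open>I\<close>; \<open>y\<close> is the measurement sequence.\<close>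

primrec local_est :: "lti \<Rightarrow> (nat set \<Rightarrow> real mat) \<Rightarrow> nat set \<Rightarrow> signal \<Rightarrow> signal" where
  "local_est G K I y 0 = 0\<^sub>v (state_dim G)"
| "local_est G K I y (Suc t) =
     matA G *\<^sub>v local_est G K I y t
     - K I *\<^sub>v (sel (output_dim G) I *\<^sub>v y t - selC G I *\<^sub>v local_est G K I y t)"

definition residual :: "lti \<Rightarrow> (nat set \<Rightarrow> real mat) \<Rightarrow> nat set \<Rightarrow> signal \<Rightarrow> signal" where
  "residual G K I y t = sel (output_dim G) I *\<^sub>v y t - selC G I *\<^sub>v local_est G K I y t"

definition sysE :: "lti \<Rightarrow> (nat set \<Rightarrow> real mat) \<Rightarrow> nat set \<Rightarrow> lti" where
  "sysE G K I = LTI (matA G + K I * selC G I) (matB G + K I * selD G I)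
                    (1\<^sub>m (state_dim G)) (0\<^sub>m (state_dim G) (input_dim G))"

definition sysF :: "lti \<Rightarrow> (nat set \<Rightarrow> real mat) \<Rightarrow> nat set \<Rightarrow> lti" where
  "sysF G K I = LTI (matA G + K I * selC G I) (matB G + K I * selD G I) (selC G I) (selD G I)"

definition valid_sets ::
  "lti \<Rightarrow> nat \<Rightarrow> (nat set \<Rightarrow> real mat) \<Rightarrow> lp \<Rightarrow> lp \<Rightarrow> signal \<Rightarrow> nat \<Rightarrow> nat set set" where
  "valid_sets G \<rho> K p q y t =
     {I \<in> sensor_sets (output_dim G) \<rho>.
        trunc_norm q t (residual G K I y) \<le> gain p q (sysF G K I)}"

definition global_est ::
  "lti \<Rightarrow> nat \<Rightarrow> (nat set \<Rightarrow> real mat) \<Rightarrow> lp \<Rightarrow> lp \<Rightarrow> signal \<Rightarrow> signal" where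
  "global_est G \<rho> K p q y t =
     (let V = valid_sets G \<rho> K p q y t in
      vec (state_dim G) (\<lambda>i. case q of
          Linf \<Rightarrow> ((MIN I\<in>V. local_est G K I y t $ i) + (MAX J\<in>V. local_est G K J y t $ i)) / 2
        | L2 \<Rightarrow> (\<Sum>I\<in>V. local_est G K I y t $ i) / real (card V)))"

definition est_error ::
  "lti \<Rightarrow> nat \<Rightarrow> (nat set \<Rightarrow> real mat) \<Rightarrow> lp \<Rightarrow> lp \<Rightarrow> signal \<Rightarrow> signal \<Rightarrow> signal" where
  "est_error G \<rho> K p q w a t = lti_state G w t - global_est G \<rho> K p q (measurement G w a) t"

text \<open>Pairs of a disturbance and an attack.\<close>

definition admissible :: "lti \<Rightarrow> nat \<Rightarrow> lp \<Rightarrow> (signal \<times> signal) set" where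
  "admissible G \<rho> p =
     {(w, a). w \<in> signals (input_dim G) \<and> a \<in> signals (output_dim G)
            \<and> signal_norm p w \<le> 1 \<and> supp_size a \<le> \<rho>}"

definition worst_case_error ::
  "lti \<Rightarrow> nat \<Rightarrow> (nat set \<Rightarrow> real mat) \<Rightarrow> lp \<Rightarrow> lp \<Rightarrow> ennreal" where
  "worst_case_error G \<rho> K p q =
     (SUP (w, a)\<in>admissible G \<rho> p. signal_norm q (est_error G \<rho> K p q w a))"

section \<open>Discrepancy between two local estimators\<close>

definition append_cols :: "real mat \<Rightarrow> real mat \<Rightarrow> real mat" where
  "append_cols M N = four_block_mat M N (0\<^sub>m 0 (dim_col M)) (0\<^sub>m 0 (dim_col N))"

definition alpha :: "lti \<Rightarrow> lp \<Rightarrow> lp \<Rightarrow> nat set \<Rightarrow> ennreal" where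
  "alpha G p q J =
     (let n = state_dim G in
      INF L\<in>{L \<in> carrier_mat n (card J). strictly_stable (matA G + L * selC G J)}.
        gain p q (LTI (matA G + L * selC G J) (append_cols (1\<^sub>m n) L)
                      (1\<^sub>m n) (0\<^sub>m n (n + card J))))"

text \<open>
  The residual norm enters through its supremum over all admissible disturbances and attacks
  and all times at which the local estimator \<open>I\<close> is valid. For \<open>p = L2\<close>, \<open>q = Linf\<close> this
  supremum can be infinite.
\<close>

definition beta ::
  "lti \<Rightarrow> nat \<Rightarrow> (nat set \<Rightarrow> real mat) \<Rightarrow> lp \<Rightarrow> lp \<Rightarrow> nat set \<Rightarrow> nat set \<Rightarrow> ennreal" where
  "beta G \<rho> K p q I J =
     mat_norm p (- K I @\<^sub>r resel (output_dim G) J I) *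
     (SUP (w, a, T)\<in>{(w, a, T). (w, a) \<in> admissible G \<rho> p
                              \<and> I \<in> valid_sets G \<rho> K p q (measurement G w a) T}.
        trunc_norm p T (residual G K I (measurement G w a)))"

definition discrepancy ::
  "lti \<Rightarrow> nat \<Rightarrow> (nat set \<Rightarrow> real mat) \<Rightarrow> lp \<Rightarrow> lp \<Rightarrow> nat set \<Rightarrow> nat set \<Rightarrow> ennreal" where
  "discrepancy G \<rho> K p q I J =
     alpha G p q (I \<inter> J) * (beta G \<rho> K p q I (I \<inter> J) + beta G \<rho> K p q J (I \<inter> J))"

end

theory Submission
  imports "HOL-Analysis.Harmonic_Numbers" Defs "Jordan_Normal_Form.Spectral_Radius"
begin

text \<open>
  Since at most \<open>\<rho>\<close> sensors are attacked, some set \<open>I\<close> of \<open>m - \<rho>\<close> sensors is free of attacks. Its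
  local estimator has the error \<open>sysE\<close> applied to \<open>w\<close> and the residual \<open>sysF\<close> applied to \<open>w\<close>
  (\<open>unattacked_estimator\<close>). So this estimator is always valid, and its error is at most the gain of
  \<open>sysE\<close>. It remains to bound the distance of the global estimate from the estimate \<open>I\<close>, and this
  rests on two ideas.

  First, any two estimators \<open>I\<close> and \<open>J\<close> that are valid at the same time are close to each other
  up to that time. On the common sensors \<open>I \<inter> J\<close> both can be rewritten as observers with one and the
  same gain \<open>L\<close>, driven by their own residuals; the measurement, attack included, cancels in the
  difference (\<open>local_est_disagreement\<close>). By \<open>2\<rho>\<close>-detectability there is a stabilizing \<open>L\<close>
  (\<open>exists_common_gain\<close>), and the infimum over \<open>L\<close> gives the discrepancy
  (\<open>trunc_norm_disagreement_le_discrepancy\<close>).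

  Second, the factors in front of the discrepancy come from the way in which the valid estimates are
  combined. For \<open>q = Linf\<close>, the midpoint of an interval that contains a point is at most half as far
  from this point as the farther end of the interval (\<open>abs_minus_midpoint_le\<close>). For \<open>q = L2\<close>, the
  estimate is an average over a set that shrinks with time. A Cauchy-Schwarz inequality
  whose weights depend on the order in which the estimators are discarded bounds the total energy of
  the averaged differences by \<open>ln (card V) / 2\<close> times the square of the discrepancy
  (\<open>survivor_weights\<close>, \<open>average_energy_le\<close>).

  For \<open>(p, q) = (L2, Linf)\<close> the discrepancy can be infinite, so that the bound does not show that the
  worst-case error is finite. The same argument does show it when the discrepancy is replaced by a
  bound obtained from the validity test (\<open>finite_disagreement_bound\<close>). This one is finite because
  strictly stable systems have finite gains (\<open>gain_finite_if_strictly_stable\<close>), by the geometric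
  decay of the powers of the state matrix.
\<close>

(* Indexing and scalar products are those of matrices and vectors whose dimensions are numbers. *)
unbundle no vec_syntax and no inner_syntax

section \<open>Norms of vectors and of truncated signals\<close>

text \<open>
  The part of the signal norms that acts in time: \<open>trunc_norm\<close> is \<open>time_norm\<close> of the sequence of
  pointwise vector norms. The few rules proved for it (monotonicity, triangle inequality, scaling,
  delay) allow all later estimates to be made once for both norms.
\<close>

fun time_norm :: "lp \<Rightarrow> nat \<Rightarrow> (nat \<Rightarrow> real) \<Rightarrow> real" where
  "time_norm L2 T f = L2_set f {..T}"
| "time_norm Linf T f = Max (f ` {..T})"

lemma vnorm_L2_eq_L2_set: "vnorm L2 v = L2_set (\<lambda>i. v $ i) {..<dim_vec v}"
  by (simp add: L2_set_def)

lemma vnorm_nonneg [simp]: "0 \<le> vnorm p v"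
  by (cases p) (auto simp: sum_nonneg intro!: Max_ge)

lemma abs_component_le_vnorm:
  assumes "i < dim_vec v"
  shows "\<bar>v $ i\<bar> \<le> vnorm p v"
proof (cases p)
  case L2
  have "(v $ i)\<^sup>2 \<le> (\<Sum>i<dim_vec v. (v $ i)\<^sup>2)"
    using assms by (intro member_le_sum) auto
  then show ?thesis using L2 by (simp add: real_le_rsqrt)
next
  case Linf
  then show ?thesis using assms by (auto intro!: Max_ge)
qed

lemma vnorm_Linf_le:
  assumes "0 \<le> c" and "\<And>i. i < dim_vec v \<Longrightarrow> \<bar>v $ i\<bar> \<le> c"
  shows "vnorm Linf v \<le> c"
  using assms by (auto intro!: Max.boundedI)

lemma vnorm_le_sum_abs: "vnorm p v \<le> (\<Sum>i<dim_vec v. \<bar>v $ i\<bar>)"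
proof (cases p)
  case L2
  then show ?thesis using L2_set_le_sum_abs by (simp only: vnorm_L2_eq_L2_set)
next
  case Linf
  then show ?thesis by (auto intro!: vnorm_Linf_le sum_nonneg member_le_sum simp del: vnorm.simps)
qed

lemma vnorm_Linf_le_L2: "vnorm Linf v \<le> vnorm L2 v"
  by (intro vnorm_Linf_le abs_component_le_vnorm vnorm_nonneg)

lemma vnorm_add_le:
  assumes "u \<in> carrier_vec d" and "v \<in> carrier_vec d"
  shows "vnorm p (u + v) \<le> vnorm p u + vnorm p v"
proof (cases p)
  case L2
  have "L2_set (\<lambda>i. (u + v) $ i) {..<d} = L2_set (\<lambda>i. u $ i + v $ i) {..<d}"
    using assms by (intro L2_set_cong) auto
  then show ?thesis
    using L2 assms L2_set_triangle_ineq[of "\<lambda>i. u $ i" "\<lambda>i. v $ i" "{..<d}"]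
    by (simp add: vnorm_L2_eq_L2_set del: vnorm.simps)
next
  case Linf
  have "\<bar>(u + v) $ i\<bar> \<le> vnorm Linf u + vnorm Linf v" if "i < dim_vec (u + v)" for i
  proof -
    have "\<bar>u $ i + v $ i\<bar> \<le> \<bar>u $ i\<bar> + \<bar>v $ i\<bar>" by (rule abs_triangle_ineq)
    also have "\<dots> \<le> vnorm Linf u + vnorm Linf v"
      using that assms by (intro add_mono abs_component_le_vnorm) auto
    finally show ?thesis using that assms by (auto simp del: vnorm.simps)
  qed
  then show ?thesis unfolding Linf by (intro vnorm_Linf_le add_nonneg_nonneg vnorm_nonneg)
qed

lemma vnorm_uminus [simp]: "vnorm p (- v) = vnorm p v"
proof (cases p)
  case L2
  have "(\<Sum>i<dim_vec v. ((- v) $ i)\<^sup>2) = (\<Sum>i<dim_vec v. (v $ i)\<^sup>2)"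
    by (intro sum.cong) auto
  then show ?thesis using L2 by simp
next
  case Linf
  have "(\<lambda>i. \<bar>(- v) $ i\<bar>) ` {..<dim_vec v} = (\<lambda>i. \<bar>v $ i\<bar>) ` {..<dim_vec v}"
    by (intro image_cong) auto
  then show ?thesis using Linf by simp
qed

lemma vnorm_diff_le:
  assumes "u \<in> carrier_vec d" and "v \<in> carrier_vec d"
  shows "vnorm p (u - v) \<le> vnorm p u + vnorm p v"
proof -
  have "u - v = u + (- v)" using assms by auto
  then show ?thesis using vnorm_add_le[of u d "- v" p] assms by simp
qed

lemma vnorm_zero [simp]: "vnorm p (0\<^sub>v d) = 0"
  using vnorm_le_sum_abs[of p "0\<^sub>v d"] vnorm_nonneg[of p "0\<^sub>v d"] by simp

lemma vnorm_eq_0D: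
  assumes "vnorm p v = 0"
  shows "v = 0\<^sub>v (dim_vec v)"
  using abs_component_le_vnorm[of _ v p] assms by (intro eq_vecI) auto

lemma vnorm_pos:
  assumes "v \<in> carrier_vec d" and "v \<noteq> 0\<^sub>v d"
  shows "0 < vnorm p v"
  using assms vnorm_eq_0D[of p v] vnorm_nonneg[of p v] by (auto simp: less_le simp del: vnorm.simps)

text \<open>
  A crude constant that serves both vector norms: each component is bounded by \<open>vnorm\<close>, and
  \<open>vnorm\<close> is bounded by the sum of the components. Only its finiteness matters, except in
  \<open>strictly_stable_pow_vnorm\<close>, where it inherits the geometric decay of the entries.
\<close>

lemma vnorm_mult_mat_le:
  fixes M :: "real mat"
  assumes "v \<in> carrier_vec (dim_col M)"
  shows "vnorm p (M *\<^sub>v v) \<le> (\<Sum>i<dim_row M. \<Sum>j<dim_col M. \<bar>M $$ (i, j)\<bar>) * vnorm p v"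
proof -
  have "\<bar>(M *\<^sub>v v) $ i\<bar> \<le> (\<Sum>j<dim_col M. \<bar>M $$ (i, j)\<bar>) * vnorm p v" if "i < dim_row M" for i
  proof -
    have "(M *\<^sub>v v) $ i = (\<Sum>j<dim_col M. M $$ (i, j) * v $ j)"
      using that assms by (auto simp: scalar_prod_def atLeast0LessThan intro!: sum.cong)
    also have "\<bar>\<dots>\<bar> \<le> (\<Sum>j<dim_col M. \<bar>M $$ (i, j)\<bar> * \<bar>v $ j\<bar>)"
      by (rule order_trans[OF sum_abs]) (simp add: abs_mult)
    also have "\<dots> \<le> (\<Sum>j<dim_col M. \<bar>M $$ (i, j)\<bar> * vnorm p v)"
      using assms by (intro sum_mono mult_left_mono abs_component_le_vnorm) auto
    finally show ?thesis by (simp add: sum_distrib_right)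
  qed
  then have "(\<Sum>i<dim_row M. \<bar>(M *\<^sub>v v) $ i\<bar>)
      \<le> (\<Sum>i<dim_row M. (\<Sum>j<dim_col M. \<bar>M $$ (i, j)\<bar>) * vnorm p v)"
    by (intro sum_mono) auto
  then show ?thesis
    using vnorm_le_sum_abs[of p "M *\<^sub>v v"] by (simp add: sum_distrib_right)
qed

lemma mat_norm_finite: "mat_norm p M < \<infinity>"
proof -
  have "ennreal (vnorm p (M *\<^sub>v v) / vnorm p v)
      \<le> ennreal (\<Sum>i<dim_row M. \<Sum>j<dim_col M. \<bar>M $$ (i, j)\<bar>)"
    if "v \<in> carrier_vec (dim_col M) - {0\<^sub>v (dim_col M)}" for v
  proof -
    have "vnorm p v > 0"
      using that by (intro vnorm_pos) auto
    then show ?thesis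
      using that vnorm_mult_mat_le[of v M p] by (intro ennreal_leI) (simp add: divide_le_eq)
  qed
  then have "mat_norm p M \<le> ennreal (\<Sum>i<dim_row M. \<Sum>j<dim_col M. \<bar>M $$ (i, j)\<bar>)"
    unfolding mat_norm_def by (intro SUP_least)
  then show ?thesis by (rule le_less_trans) simp
qed

lemma vnorm_mult_mat_le_mat_norm:
  assumes "v \<in> carrier_vec (dim_col M)"
  shows "vnorm p (M *\<^sub>v v) \<le> enn2real (mat_norm p M) * vnorm p v"
proof (cases "v = 0\<^sub>v (dim_col M)")
  case True
  have "M *\<^sub>v v = 0\<^sub>v (dim_row M)" unfolding True by (intro eq_vecI) auto
  then show ?thesis using True by simp
next
  case False
  then have pos: "vnorm p v > 0"
    using assms by (intro vnorm_pos) auto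
  have "ennreal (vnorm p (M *\<^sub>v v) / vnorm p v) \<le> mat_norm p M"
    unfolding mat_norm_def using False assms by (intro SUP_upper) auto
  then have "enn2real (ennreal (vnorm p (M *\<^sub>v v) / vnorm p v)) \<le> enn2real (mat_norm p M)"
    using mat_norm_finite[of p M] by (intro enn2real_mono) auto
  then show ?thesis using pos by (simp add: divide_le_eq)
qed

lemma time_norm_nonneg:
  assumes "\<And>t. 0 \<le> f t"
  shows "0 \<le> time_norm p T f"
  using assms by (cases p) (auto simp: Max_ge_iff)

lemma time_norm_mono:
  assumes "\<And>t. t \<le> T \<Longrightarrow> f t \<le> g t" and "\<And>t. 0 \<le> f t"
  shows "time_norm p T f \<le> time_norm p T g"
proof (cases p)
  case L2
  then show ?thesis using assms by (auto intro!: L2_set_mono)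
next
  case Linf
  have "f t \<le> Max (g ` {..T})" if "t \<le> T" for t
    using that assms(1)[OF that] by (auto intro: order_trans[OF _ Max_ge])
  then show ?thesis using Linf by auto
qed

lemma time_norm_add_le: "time_norm p T (\<lambda>t. f t + g t) \<le> time_norm p T f + time_norm p T g"
  by (cases p) (auto intro!: L2_set_triangle_ineq add_mono)

lemma time_norm_cmult:
  assumes "0 \<le> c"
  shows "time_norm p T (\<lambda>t. c * f t) = c * time_norm p T f"
proof (cases p)
  case L2
  then show ?thesis using assms by (simp add: L2_set_right_distrib)
next
  case Linf
  have "mono ((*) c)" using assms by (auto intro!: monoI mult_left_mono)
  then have "c * Max (f ` {..T}) = Max ((*) c ` f ` {..T})" by (rule mono_Max_commute) auto
  then show ?thesis using Linf by (simp add: image_image)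
qed

lemma time_norm_delay_le:
  assumes "\<And>t. 0 \<le> f t"
  shows "time_norm p T (\<lambda>t. case t of 0 \<Rightarrow> 0 | Suc t' \<Rightarrow> f t') \<le> time_norm p T f"
proof (cases p)
  case L2
  have "(\<Sum>t\<le>T. (case t of 0 \<Rightarrow> 0 | Suc t' \<Rightarrow> f t')\<^sup>2) \<le> (\<Sum>t\<le>T. (f t)\<^sup>2)"
  proof (cases T)
    case (Suc T')
    show ?thesis unfolding Suc by (subst sum.atMost_Suc_shift) simp
  qed simp
  then show ?thesis using L2 by (simp add: L2_set_def)
next
  case Linf
  have "(case t of 0 \<Rightarrow> 0 | Suc t' \<Rightarrow> f t') \<le> Max (f ` {..T})" if "t \<le> T" for t
  proof (cases t)
    case 0
    then show ?thesis using assms[of 0] by (auto simp: Max_ge_iff)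
  next
    case (Suc t')
    then show ?thesis using that by (auto intro!: Max_ge)
  qed
  then show ?thesis using Linf by auto
qed

lemma trunc_norm_eq_time_norm: "trunc_norm p T x = ennreal (time_norm p T (\<lambda>t. vnorm p (x t)))"
proof (cases p)
  case L2
  then show ?thesis by (simp add: L2_set_def sum_nonneg)
next
  case Linf
  have mono: "mono ennreal" by (auto intro!: monoI ennreal_leI)
  have "ennreal (Max ((\<lambda>t. vnorm Linf (x t)) ` {..T}))
      = Max (ennreal ` (\<lambda>t. vnorm Linf (x t)) ` {..T})"
    by (rule mono_Max_commute[OF mono]) auto
  also have "\<dots> = (SUP t\<in>{..T}. ennreal (vnorm Linf (x t)))"
    by (subst Max_Sup) (auto simp: image_image)
  finally show ?thesis using Linf by (simp del: vnorm.simps)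
qed

lemma trunc_norm_cong:
  assumes "\<And>t. t \<le> T \<Longrightarrow> x t = y t"
  shows "trunc_norm p T x = trunc_norm p T y"
  using assms by (cases p) (auto intro!: SUP_cong)

lemma trunc_norm_mono_time:
  assumes "S \<le> T"
  shows "trunc_norm p S x \<le> trunc_norm p T x"
proof (cases p)
  case L2
  then show ?thesis using assms by (auto intro!: ennreal_leI sum_mono2 sum_nonneg)
next
  case Linf
  then show ?thesis using assms by (auto intro!: SUP_subset_mono)
qed

lemma vnorm_le_trunc_norm: "ennreal (vnorm p (x T)) \<le> trunc_norm p T x"
proof (cases p)
  case L2
  have "(\<Sum>i<dim_vec (x T). (x T $ i)\<^sup>2) \<le> (\<Sum>t\<le>T. \<Sum>i<dim_vec (x t). (x t $ i)\<^sup>2)"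
    by (rule member_le_sum[where f = "\<lambda>t. \<Sum>i<dim_vec (x t). (x t $ i)\<^sup>2"])
      (auto intro!: sum_nonneg)
  then show ?thesis using L2 by (auto intro!: ennreal_leI)
next
  case Linf
  then show ?thesis by (auto intro!: SUP_upper simp del: vnorm.simps)
qed

lemma trunc_norm_le_signal_norm: "trunc_norm p T x \<le> signal_norm p x"
proof (cases p)
  case L2
  let ?s = "\<lambda>t. \<Sum>i<dim_vec (x t). (x t $ i)\<^sup>2"
  have "summable ?s \<Longrightarrow> sum ?s {..T} \<le> suminf ?s"
    by (rule sum_le_suminf) (auto intro!: sum_nonneg)
  then show ?thesis using L2 by (auto intro!: ennreal_leI)
next
  case Linf
  then show ?thesis by (auto intro!: SUP_subset_mono)
qed

text \<open>
  Together with \<open>trunc_norm_le_signal_norm\<close>, this makes the signal norm the supremum of the truncated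
  norms, so that it is enough to work on finite horizons.
\<close>

lemma signal_norm_le_trunc:
  assumes "\<And>T. trunc_norm p T x \<le> c"
  shows "signal_norm p x \<le> c"
proof (cases p)
  case L2
  let ?s = "\<lambda>t. \<Sum>i<dim_vec (x t). (x t $ i)\<^sup>2"
  have nonneg: "0 \<le> ?s t" for t by (intro sum_nonneg) auto
  show ?thesis
  proof (cases c)
    case (real r)
    have le: "sum ?s {..T} \<le> r\<^sup>2" for T
    proof -
      have "ennreal (sqrt (sum ?s {..T})) \<le> ennreal r"
        using assms[of T] L2 real by simp
      then have "sqrt (sum ?s {..T}) \<le> r" using real by (simp add: ennreal_le_iff)
      then show ?thesis by (rule sqrt_le_D)
    qed
    have le': "sum ?s {..<N} \<le> r\<^sup>2" for N
      by (rule order_trans[OF sum_mono2 le[of N]]) (auto simp: nonneg)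
    have sm: "summable ?s" by (rule summableI_nonneg_bounded[OF nonneg le'])
    have "suminf ?s \<le> r\<^sup>2" by (rule suminf_le_const[OF sm le'])
    then have "sqrt (suminf ?s) \<le> r" using real by (simp add: real_le_lsqrt)
    then show ?thesis using L2 sm real by (auto intro!: ennreal_leI)
  qed simp
next
  case Linf
  show ?thesis unfolding Linf signal_norm.simps
    using order_trans[OF vnorm_le_trunc_norm assms] Linf by (auto intro!: SUP_least)
qed

lemma trunc_norm_add_le:
  assumes "\<And>t. x t \<in> carrier_vec d" and "\<And>t. y t \<in> carrier_vec d"
  shows "trunc_norm p T (\<lambda>t. x t + y t) \<le> trunc_norm p T x + trunc_norm p T y"
proof -
  have "time_norm p T (\<lambda>t. vnorm p (x t + y t))
      \<le> time_norm p T (\<lambda>t. vnorm p (x t) + vnorm p (y t))"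
    using assms by (intro time_norm_mono vnorm_add_le) auto
  also have "\<dots> \<le> time_norm p T (\<lambda>t. vnorm p (x t)) + time_norm p T (\<lambda>t. vnorm p (y t))"
    by (rule time_norm_add_le)
  finally show ?thesis
    by (simp add: trunc_norm_eq_time_norm time_norm_nonneg flip: ennreal_plus)
qed

lemma trunc_norm_diff_le:
  assumes "\<And>t. x t \<in> carrier_vec d" and "\<And>t. y t \<in> carrier_vec d"
  shows "trunc_norm p T (\<lambda>t. x t - y t) \<le> trunc_norm p T x + trunc_norm p T y"
proof -
  have "time_norm p T (\<lambda>t. vnorm p (x t - y t))
      \<le> time_norm p T (\<lambda>t. vnorm p (x t) + vnorm p (y t))"
    using assms by (intro time_norm_mono vnorm_diff_le) auto
  also have "\<dots> \<le> time_norm p T (\<lambda>t. vnorm p (x t)) + time_norm p T (\<lambda>t. vnorm p (y t))"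
    by (rule time_norm_add_le)
  finally show ?thesis
    by (simp add: trunc_norm_eq_time_norm time_norm_nonneg flip: ennreal_plus)
qed

lemma trunc_norm_mult_mat_le:
  assumes "\<And>t. x t \<in> carrier_vec (dim_col M)"
  shows "trunc_norm p T (\<lambda>t. M *\<^sub>v x t) \<le> mat_norm p M * trunc_norm p T x"
proof -
  have "time_norm p T (\<lambda>t. vnorm p (M *\<^sub>v x t))
      \<le> time_norm p T (\<lambda>t. enn2real (mat_norm p M) * vnorm p (x t))"
    using assms by (intro time_norm_mono vnorm_mult_mat_le_mat_norm) auto
  also have "\<dots> = enn2real (mat_norm p M) * time_norm p T (\<lambda>t. vnorm p (x t))"
    by (simp add: time_norm_cmult)
  finally have "trunc_norm p T (\<lambda>t. M *\<^sub>v x t)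
      \<le> ennreal (enn2real (mat_norm p M)) * trunc_norm p T x"
    by (simp add: trunc_norm_eq_time_norm time_norm_nonneg ennreal_leI flip: ennreal_mult)
  then show ?thesis using mat_norm_finite[of p M] by simp
qed

section \<open>Gains of stable systems\<close>

definition lti_carrier :: "nat \<Rightarrow> nat \<Rightarrow> nat \<Rightarrow> lti \<Rightarrow> bool" where
  "lti_carrier n l k G \<longleftrightarrow> matA G \<in> carrier_mat n n \<and> matB G \<in> carrier_mat n l
     \<and> matC G \<in> carrier_mat k n \<and> matD G \<in> carrier_mat k l"

lemma lti_state_carrier:
  assumes "lti_carrier n l k G"
  shows "lti_state G w t \<in> carrier_vec n"
  by (rule carrier_vecI, cases t) (use assms in \<open>auto simp: lti_carrier_def\<close>)

lemma lti_output_carrier: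
  assumes "lti_carrier n l k G"
  shows "lti_output G w t \<in> carrier_vec k"
  by (rule carrier_vecI) (use assms in \<open>auto simp: lti_carrier_def lti_output_def\<close>)

lemma lti_state_causal:
  assumes "\<And>s. s < t \<Longrightarrow> w s = u s"
  shows "lti_state G w t = lti_state G u t"
  using assms by (induction t) auto

lemma lti_output_causal:
  assumes "\<And>s. s \<le> t \<Longrightarrow> w s = u s"
  shows "lti_output G w t = lti_output G u t"
  using assms lti_state_causal[of t w u G] by (simp add: lti_output_def)

text \<open>
  Signals of norm zero are excluded from the supremum that defines the gain; this lemma supplies the
  bound for them.
\<close>

lemma lti_output_zero_input:
  assumes G: "lti_carrier n l k G" and w: "\<And>t. w t = 0\<^sub>v l"
  shows "lti_output G w t = 0\<^sub>v k"
proof -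
  have *: "M *\<^sub>v 0\<^sub>v c = 0\<^sub>v r" if "M \<in> carrier_mat r c" for M :: "real mat" and r c
    using that by (intro eq_vecI) auto
  have "lti_state G w t = 0\<^sub>v n"
    using G by (induction t) (auto simp: lti_carrier_def w *)
  then show ?thesis using G by (auto simp: lti_carrier_def lti_output_def w *)
qed

lemma signal_norm_eq_0D:
  assumes "signal_norm p w = 0"
  shows "w t = 0\<^sub>v (dim_vec (w t))"
proof -
  have "ennreal (vnorm p (w t)) \<le> 0"
    using order_trans[OF vnorm_le_trunc_norm trunc_norm_le_signal_norm, of p w t] assms by simp
  then have "vnorm p (w t) = 0" by (intro antisym vnorm_nonneg) (simp add: ennreal_eq_0_iff)
  then show ?thesis by (rule vnorm_eq_0D)
qed

lemma signal_norm_lti_output_le: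
  assumes G: "lti_carrier n l k G" and w: "w \<in> signals l" and fin: "signal_norm p w < \<infinity>"
  shows "signal_norm q (lti_output G w) \<le> gain p q G * signal_norm p w"
proof (cases "signal_norm p w = 0")
  case True
  have "w t = 0\<^sub>v l" for t
    using signal_norm_eq_0D[OF True, of t] w by (metis (mono_tags) carrier_vecD mem_Collect_eq signals_def)
  then have "lti_output G w t = 0\<^sub>v k" for t by (rule lti_output_zero_input[OF G])
  then have "trunc_norm q T (lti_output G w) = 0" for T
    by (cases q) (auto simp: trunc_norm_eq_time_norm L2_set_def simp del: vnorm.simps trunc_norm.simps)
  then show ?thesis by (intro signal_norm_le_trunc) (simp del: trunc_norm.simps)
next
  case False
  have l: "input_dim G = l" using G by (auto simp: lti_carrier_def)
  have "signal_norm q (lti_output G w) / signal_norm p w \<le> gain p q G"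
    unfolding gain_def using False fin w l
    by (intro SUP_upper) (auto simp: zero_less_iff_neq_zero simp del: signal_norm.simps)
  then have "signal_norm q (lti_output G w) / signal_norm p w * signal_norm p w
      \<le> gain p q G * signal_norm p w"
    by (rule mult_right_mono) simp
  moreover have "signal_norm q (lti_output G w) / signal_norm p w * signal_norm p w
      = signal_norm q (lti_output G w)"
    using False fin by (intro ennreal_divide_times[THEN trans])
      (simp add: ennreal_divide_self del: signal_norm.simps)
  ultimately show ?thesis by simp
qed

lemma time_norm_truncate_le:
  assumes "\<And>t. 0 \<le> f t"
  shows "time_norm p S (\<lambda>t. if t \<le> T then f t else 0) \<le> time_norm p T f"
proof (cases p)
  case L2
  have "(\<Sum>t\<le>S. (if t \<le> T then f t else 0)\<^sup>2) = (\<Sum>t\<in>{..S} \<inter> {..T}. (f t)\<^sup>2)"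
    by (rule sum.mono_neutral_cong_right) auto
  also have "\<dots> \<le> (\<Sum>t\<le>T. (f t)\<^sup>2)" by (rule sum_mono2) auto
  finally show ?thesis using L2 by (simp add: L2_set_def)
next
  case Linf
  have "0 \<le> Max (f ` {..T})" using assms[of 0] by (auto simp: Max_ge_iff)
  then show ?thesis using Linf by (auto intro!: Max.boundedI)
qed

text \<open>
  By causality, the output up to time \<open>T\<close> does not change when the input is set to zero after
  \<open>T\<close>, and the input so modified has a finite norm. Thus the gain also bounds truncated outputs, even
  if the untruncated input has infinite norm.
\<close>

lemma trunc_norm_lti_output_le:
  assumes G: "lti_carrier n l k G" and u: "\<And>t. u t \<in> carrier_vec l"
  shows "trunc_norm q T (lti_output G u) \<le> gain p q G * trunc_norm p T u"
proof -
  define u' where "u' t = (if t \<le> T then u t else 0\<^sub>v l)" for t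
  have norm: "signal_norm p u' \<le> trunc_norm p T u"
  proof (rule signal_norm_le_trunc)
    fix S
    have "(\<lambda>t. vnorm p (u' t)) = (\<lambda>t. if t \<le> T then vnorm p (u t) else 0)"
      by (auto simp: u'_def)
    then show "trunc_norm p S u' \<le> trunc_norm p T u"
      by (simp add: trunc_norm_eq_time_norm time_norm_truncate_le ennreal_leI)
  qed
  have "trunc_norm q T (lti_output G u) = trunc_norm q T (lti_output G u')"
    by (intro trunc_norm_cong lti_output_causal) (auto simp: u'_def)
  also have "\<dots> \<le> signal_norm q (lti_output G u')" by (rule trunc_norm_le_signal_norm)
  also have "\<dots> \<le> gain p q G * signal_norm p u'"
  proof (rule signal_norm_lti_output_le[OF G])
    show "u' \<in> signals l" using u by (auto simp: u'_def signals_def)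
    show "signal_norm p u' < \<infinity>"
      by (rule le_less_trans[OF norm]) (simp add: trunc_norm_eq_time_norm)
  qed
  also have "\<dots> \<le> gain p q G * trunc_norm p T u" by (rule mult_left_mono[OF norm]) simp
  finally show ?thesis .
qed

lemma smult_mat_pow:
  fixes M :: "'a :: comm_semiring_1 mat"
  assumes M: "M \<in> carrier_mat n n"
  shows "(c \<cdot>\<^sub>m M) ^\<^sub>m k = c ^ k \<cdot>\<^sub>m (M ^\<^sub>m k)"
proof (induction k)
  case 0
  then show ?case using M by (intro eq_matI) auto
next
  case (Suc k)
  have Mk: "M ^\<^sub>m k \<in> carrier_mat n n" using M by simp
  have "(c \<cdot>\<^sub>m M) ^\<^sub>m Suc k = c ^ k \<cdot>\<^sub>m (M ^\<^sub>m k) * (c \<cdot>\<^sub>m M)" using Suc by simp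
  also have "\<dots> = c ^ k \<cdot>\<^sub>m (c \<cdot>\<^sub>m (M ^\<^sub>m k * M))"
    using mult_smult_assoc_mat[OF Mk, of "c \<cdot>\<^sub>m M" n "c ^ k"] mult_smult_distrib[OF Mk M, of c] M
    by simp
  also have "\<dots> = c ^ Suc k \<cdot>\<^sub>m (M ^\<^sub>m Suc k)"
    using M by (intro eq_matI) (auto simp: ac_simps)
  finally show ?case .
qed

text \<open>
  Pick \<open>s\<close> between the spectral radius and 1. The spectral radius of \<open>M / s\<close> is still below
  1, so by the Jordan normal form its powers are bounded, which is the geometric decay of the powers
  of \<open>M\<close>.
\<close>

lemma strictly_stable_pow_entries:
  assumes M: "M \<in> carrier_mat n n" and stable: "strictly_stable M"
  obtains c s where "0 \<le> c" and "0 < s" and "s < 1"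
    and "\<And>k i j. i < n \<Longrightarrow> j < n \<Longrightarrow> \<bar>(M ^\<^sub>m k) $$ (i, j)\<bar> \<le> c * s ^ k"
proof (cases "n = 0")
  case True
  then show ?thesis using that[of 0 "1 / 2"] by auto
next
  case False
  define A where "A = map_mat complex_of_real M"
  have A: "A \<in> carrier_mat n n" using M by (simp add: A_def)
  define r where "r = spectral_radius A"
  have "r \<in> norm ` spectrum A" unfolding r_def
    using spectral_radius_mem_max(1)[OF A] False by simp
  then have r: "0 \<le> r" "r < 1"
    using stable by (auto simp: strictly_stable_def A_def spectrum_def)
  define s where "s = (r + 1) / 2"
  have s: "0 < s" "s < 1" "r < s" using r by (auto simp: s_def)
  define B where "B = complex_of_real (1 / s) \<cdot>\<^sub>m A"
  have B: "B \<in> carrier_mat n n" using A by (simp add: B_def)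
  have "norm z < 1" if "z \<in> spectrum B" for z
  proof -
    from that obtain v where v: "v \<in> carrier_vec n" "v \<noteq> 0\<^sub>v n" "B *\<^sub>v v = z \<cdot>\<^sub>v v"
      using B by (auto simp: spectrum_def eigenvalue_def eigenvector_def)
    have "A = complex_of_real s \<cdot>\<^sub>m B" using s A by (intro eq_matI) (auto simp: B_def)
    then have "A *\<^sub>v v = complex_of_real s \<cdot>\<^sub>v (B *\<^sub>v v)"
      using B v(1) by (intro eq_vecI) (auto simp: scalar_prod_def sum_distrib_left mult.assoc)
    also have "\<dots> = (complex_of_real s * z) \<cdot>\<^sub>v v" using v by (simp add: smult_smult_assoc)
    finally have "complex_of_real s * z \<in> spectrum A"
      using v A by (auto simp: spectrum_def eigenvalue_def eigenvector_def)
    then have "norm (complex_of_real s * z) \<le> r" unfolding r_def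
      using spectral_radius_mem_max(2)[OF A] False by blast
    then have "s * norm z \<le> r" using s by (simp add: norm_mult)
    then have "s * norm z < s * 1" using s by linarith
    then show ?thesis using s by simp
  qed
  then have "spectral_radius B < 1"
    using spectral_radius_mem_max(1)[OF B] False by auto
  then obtain c where c: "\<And>k. norm_bound (B ^\<^sub>m k) c"
    using spectral_radius_jnf_norm_bound_less_1_upper_triangular[OF B] by auto
  have "\<bar>(M ^\<^sub>m k) $$ (i, j)\<bar> \<le> max c 0 * s ^ k" if "i < n" "j < n" for k i j
  proof -
    have Mk: "M ^\<^sub>m k \<in> carrier_mat n n" using M by simp
    have "map_mat complex_of_real (M ^\<^sub>m k) = A ^\<^sub>m k"
      unfolding A_def by (rule of_real_hom.mat_hom_pow[OF M])
    then have "B ^\<^sub>m k = complex_of_real (1 / s) ^ k \<cdot>\<^sub>m map_mat complex_of_real (M ^\<^sub>m k)"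
      unfolding B_def using smult_mat_pow[OF A] by simp
    then have "(B ^\<^sub>m k) $$ (i, j) = complex_of_real (1 / s) ^ k * complex_of_real ((M ^\<^sub>m k) $$ (i, j))"
      using carrier_matD[OF M] that by simp
    then have "norm ((B ^\<^sub>m k) $$ (i, j)) = \<bar>(M ^\<^sub>m k) $$ (i, j)\<bar> / s ^ k"
      using s by (simp add: norm_mult norm_power norm_divide power_divide)
    moreover have "norm ((B ^\<^sub>m k) $$ (i, j)) \<le> c"
      using c[of k] that carrier_matD[OF B] by (simp add: norm_bound_def)
    ultimately have "\<bar>(M ^\<^sub>m k) $$ (i, j)\<bar> \<le> c * s ^ k" using s by (simp add: divide_le_eq)
    also have "\<dots> \<le> max c 0 * s ^ k" using s by (intro mult_right_mono) auto
    finally show ?thesis .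
  qed
  then show ?thesis using s by (intro that[of "max c 0" s]) auto
qed

lemma strictly_stable_pow_vnorm:
  assumes M: "M \<in> carrier_mat n n" and stable: "strictly_stable M"
  obtains c s where "0 \<le> c" and "0 < s" and "s < 1"
    and "\<And>k v. v \<in> carrier_vec n \<Longrightarrow> vnorm p (M ^\<^sub>m k *\<^sub>v v) \<le> s ^ k * (c * vnorm p v)"
proof -
  obtain c s where c: "0 \<le> c" and s: "0 < s" "s < 1"
    and bound: "\<And>k i j. i < n \<Longrightarrow> j < n \<Longrightarrow> \<bar>(M ^\<^sub>m k) $$ (i, j)\<bar> \<le> c * s ^ k"
    using strictly_stable_pow_entries[OF M stable] by blast
  have "vnorm p (M ^\<^sub>m k *\<^sub>v v) \<le> s ^ k * ((real n * real n * c) * vnorm p v)"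
    if v: "v \<in> carrier_vec n" for k v
  proof -
    have Mk: "M ^\<^sub>m k \<in> carrier_mat n n" using M by simp
    have "vnorm p (M ^\<^sub>m k *\<^sub>v v) \<le> (\<Sum>i<n. \<Sum>j<n. \<bar>(M ^\<^sub>m k) $$ (i, j)\<bar>) * vnorm p v"
      using vnorm_mult_mat_le[of v "M ^\<^sub>m k" p] v carrier_matD[OF M] carrier_matD[OF Mk]
      by (simp only: carrier_vec_def mem_Collect_eq)
    also have "\<dots> \<le> (\<Sum>i<n. \<Sum>j<n. c * s ^ k) * vnorm p v"
      using bound by (intro mult_right_mono sum_mono) auto
    finally show ?thesis by (simp add: algebra_simps)
  qed
  then show ?thesis using c s by (intro that[of "real n * real n * c" s]) auto
qed

text \<open>
  The solution of the scalar recursion that dominates the norm of the state of a stable system.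
\<close>

primrec leaky_sum :: "real \<Rightarrow> (nat \<Rightarrow> real) \<Rightarrow> nat \<Rightarrow> real" where
  "leaky_sum s u 0 = 0"
| "leaky_sum s u (Suc t) = s * leaky_sum s u t + u t"

text \<open>
  The leaky sum is \<open>s\<close> times its own delay plus the delay of \<open>u\<close>, and a delay does not increase
  the norm. Hence the norm \<open>N\<close> of the leaky sum satisfies \<open>N \<le> s * N + \<parallel>u\<parallel>\<close>, which takes the
  place of Young's inequality for convolutions.
\<close>

lemma time_norm_leaky_sum_le:
  assumes s: "0 \<le> s" "s < 1" and u: "\<And>t. 0 \<le> u t"
  shows "(1 - s) * time_norm p T (leaky_sum s u) \<le> time_norm p T u"
proof -
  let ?delay = "\<lambda>f t. case t of 0 \<Rightarrow> 0 | Suc t' \<Rightarrow> (f t' :: real)"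
  have nonneg: "0 \<le> leaky_sum s u t" for t using s u by (induction t) auto
  have "leaky_sum s u = (\<lambda>t. s * ?delay (leaky_sum s u) t + ?delay u t)"
    by (rule ext) (simp split: nat.split)
  then have "time_norm p T (leaky_sum s u)
      \<le> time_norm p T (\<lambda>t. s * ?delay (leaky_sum s u) t) + time_norm p T (?delay u)"
    using time_norm_add_le[of p T "\<lambda>t. s * ?delay (leaky_sum s u) t" "?delay u"] by simp
  also have "\<dots> \<le> s * time_norm p T (leaky_sum s u) + time_norm p T u"
    unfolding time_norm_cmult[OF s(1)] using s nonneg u
    by (intro add_mono mult_left_mono time_norm_delay_le) auto
  finally show ?thesis by (simp add: algebra_simps)
qed

text \<open>
  One application of the state matrix need not contract the norm; only its powers decay. The claim is
  therefore proved for all powers \<open>j\<close> at once, which makes the induction over time go through.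
  The case \<open>j = 0\<close> is the one of interest.
\<close>

lemma lti_state_le_leaky_sum:
  assumes G: "lti_carrier n l k G" and w: "\<And>t. w t \<in> carrier_vec l"
    and c: "0 \<le> c" and s: "0 < s"
    and pow: "\<And>k v. v \<in> carrier_vec n \<Longrightarrow> vnorm p (matA G ^\<^sub>m k *\<^sub>v v) \<le> s ^ k * (c * vnorm p v)"
  shows "vnorm p (matA G ^\<^sub>m j *\<^sub>v lti_state G w t)
    \<le> s ^ j * leaky_sum s (\<lambda>t. c * vnorm p (matB G *\<^sub>v w t)) t"
proof (induction t arbitrary: j)
  case 0
  have "matA G ^\<^sub>m j *\<^sub>v 0\<^sub>v n = 0\<^sub>v n"
    using G by (intro eq_vecI) (auto simp: lti_carrier_def)
  then show ?case using G by (auto simp: lti_carrier_def)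
next
  case (Suc t)
  let ?a = "leaky_sum s (\<lambda>t. c * vnorm p (matB G *\<^sub>v w t))"
  have A: "matA G \<in> carrier_mat n n" and Aj: "matA G ^\<^sub>m j \<in> carrier_mat n n"
    using G by (auto simp: lti_carrier_def)
  have x: "lti_state G w t \<in> carrier_vec n" by (rule lti_state_carrier[OF G])
  have Bw: "matB G *\<^sub>v w t \<in> carrier_vec n" using G w by (auto simp: lti_carrier_def)
  have step: "matA G ^\<^sub>m j *\<^sub>v lti_state G w (Suc t)
      = matA G ^\<^sub>m Suc j *\<^sub>v lti_state G w t + matA G ^\<^sub>m j *\<^sub>v (matB G *\<^sub>v w t)"
    using mult_add_distrib_mat_vec[OF Aj, of "matA G *\<^sub>v lti_state G w t" "matB G *\<^sub>v w t"]
      assoc_mult_mat_vec[OF Aj A x] A x Bw by simp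
  have "vnorm p (matA G ^\<^sub>m j *\<^sub>v lti_state G w (Suc t))
      \<le> vnorm p (matA G ^\<^sub>m Suc j *\<^sub>v lti_state G w t) + vnorm p (matA G ^\<^sub>m j *\<^sub>v (matB G *\<^sub>v w t))"
    unfolding step by (rule vnorm_add_le[where d = n]) (use mult_mat_vec_carrier[OF Aj Bw]
        mult_mat_vec_carrier[OF mult_carrier_mat[OF Aj A] x] in auto)
  also have "\<dots> \<le> s ^ Suc j * ?a t + s ^ j * (c * vnorm p (matB G *\<^sub>v w t))"
    by (intro add_mono Suc.IH pow Bw)
  finally show ?case by (simp add: algebra_simps)
qed

lemma gain_finite_if_strictly_stable:
  assumes G: "lti_carrier n l k G" and stable: "strictly_stable (matA G)"
  shows "gain p p G < \<infinity>"
proof -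
  have A: "matA G \<in> carrier_mat n n" and B: "matB G \<in> carrier_mat n l"
    and C: "matC G \<in> carrier_mat k n" and D: "matD G \<in> carrier_mat k l"
    using G by (auto simp: lti_carrier_def)
  obtain c s where c: "0 \<le> c" and s: "0 < s" "s < 1"
    and pow: "\<And>k v. v \<in> carrier_vec n \<Longrightarrow> vnorm p (matA G ^\<^sub>m k *\<^sub>v v) \<le> s ^ k * (c * vnorm p v)"
    using strictly_stable_pow_vnorm[OF A stable] by blast
  let ?nB = "enn2real (mat_norm p (matB G))"
  let ?nC = "enn2real (mat_norm p (matC G))"
  let ?nD = "enn2real (mat_norm p (matD G))"
  define b where "b = ?nC * (c * ?nB / (1 - s)) + ?nD"
  have b: "0 \<le> b" using c s by (auto simp: b_def intro!: add_nonneg_nonneg mult_nonneg_nonneg divide_nonneg_nonneg)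
  have "signal_norm p (lti_output G w) / signal_norm p w \<le> ennreal b"
    if w: "w \<in> signals l" and pos: "0 < signal_norm p w" for w
  proof (rule divide_le_posI_ennreal[OF pos], rule signal_norm_le_trunc)
    fix T
    have wt: "w t \<in> carrier_vec l" for t using w by (auto simp: signals_def)
    let ?x = "lti_state G w" and ?u = "\<lambda>t. vnorm p (w t)"
    let ?a = "leaky_sum s (\<lambda>t. c * vnorm p (matB G *\<^sub>v w t))"
    have x: "?x t \<in> carrier_vec n" for t by (rule lti_state_carrier[OF G])
    have a: "0 \<le> ?a t" for t using s c by (induction t) auto
    have "(1 - s) * time_norm p T ?a \<le> time_norm p T (\<lambda>t. c * vnorm p (matB G *\<^sub>v w t))"
      using s c by (intro time_norm_leaky_sum_le) auto
    also have "\<dots> \<le> time_norm p T (\<lambda>t. (c * ?nB) * ?u t)"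
      using c wt B vnorm_mult_mat_le_mat_norm[of "w _" "matB G" p]
      by (intro time_norm_mono) (auto simp: mult.assoc intro!: mult_left_mono simp del: vnorm.simps)
    also have "\<dots> = (c * ?nB) * time_norm p T ?u" using c by (simp add: time_norm_cmult)
    finally have state: "time_norm p T ?a \<le> (c * ?nB / (1 - s)) * time_norm p T ?u"
      using s by (simp add: field_simps)
    have "vnorm p (lti_output G w t) \<le> ?nC * ?a t + ?nD * ?u t" for t
    proof -
      have x0: "matA G ^\<^sub>m 0 *\<^sub>v ?x t = ?x t" using A x by simp
      have "vnorm p (?x t) \<le> ?a t"
        using lti_state_le_leaky_sum[where w = w and j = 0 and t = t, OF G wt c s(1) pow]
        unfolding x0 by simp
      moreover have "vnorm p (lti_output G w t)
          \<le> vnorm p (matC G *\<^sub>v ?x t) + vnorm p (matD G *\<^sub>v w t)"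
        unfolding lti_output_def using C D x wt by (intro vnorm_add_le[of _ k]) auto
      moreover have "vnorm p (matC G *\<^sub>v ?x t) \<le> ?nC * vnorm p (?x t)"
        using C x by (intro vnorm_mult_mat_le_mat_norm) auto
      moreover have "vnorm p (matD G *\<^sub>v w t) \<le> ?nD * ?u t"
        using D wt by (intro vnorm_mult_mat_le_mat_norm) auto
      moreover have "?nC * vnorm p (?x t) \<le> ?nC * ?a t"
        using calculation(1) by (intro mult_left_mono) auto
      ultimately show ?thesis by linarith
    qed
    then have "time_norm p T (\<lambda>t. vnorm p (lti_output G w t))
        \<le> time_norm p T (\<lambda>t. ?nC * ?a t + ?nD * ?u t)" by (intro time_norm_mono) auto
    also have "\<dots> \<le> time_norm p T (\<lambda>t. ?nC * ?a t) + time_norm p T (\<lambda>t. ?nD * ?u t)"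
      by (rule time_norm_add_le)
    also have "\<dots> = ?nC * time_norm p T ?a + ?nD * time_norm p T ?u" by (simp add: time_norm_cmult)
    also have "\<dots> \<le> ?nC * ((c * ?nB / (1 - s)) * time_norm p T ?u) + ?nD * time_norm p T ?u"
      by (intro add_mono mult_left_mono state) auto
    also have "\<dots> = b * time_norm p T ?u" by (simp add: b_def algebra_simps)
    finally have "trunc_norm p T (lti_output G w) \<le> ennreal b * trunc_norm p T w"
      using b by (simp add: trunc_norm_eq_time_norm time_norm_nonneg ennreal_leI flip: ennreal_mult)
    also have "\<dots> \<le> ennreal b * signal_norm p w"
      by (intro mult_left_mono trunc_norm_le_signal_norm) simp
    finally show "trunc_norm p T (lti_output G w) \<le> signal_norm p w * ennreal b"
      by (simp add: mult.commute)
  qed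
  then have "gain p p G \<le> ennreal b"
    unfolding gain_def using B by (intro SUP_least) (auto simp del: signal_norm.simps)
  then show ?thesis by (rule le_less_trans) simp
qed

lemma signal_norm_Linf_le_L2: "signal_norm Linf x \<le> signal_norm L2 x"
proof -
  have "ennreal (vnorm Linf (x t)) \<le> signal_norm L2 x" for t
    using vnorm_Linf_le_L2[of "x t"] vnorm_le_trunc_norm[of L2 x t] trunc_norm_le_signal_norm[of L2 t x]
    by (meson ennreal_leI order_trans)
  then show ?thesis by (auto intro!: SUP_least simp del: vnorm.simps signal_norm.simps(1))
qed

lemma gain_L2_Linf_le_L2_L2: "gain L2 Linf G \<le> gain L2 L2 G"
  unfolding gain_def
  by (intro SUP_mono') (simp add: divide_right_mono_ennreal signal_norm_Linf_le_L2 del: signal_norm.simps)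

section \<open>Sensor selection\<close>

lemma sel_carrier [simp, intro]:
  assumes "finite I"
  shows "sel m I \<in> carrier_mat (card I) m"
  using assms by (auto simp: sel_def intro!: mat_of_rows_carrier)

lemma row_sel:
  assumes "I \<subseteq> {0..<m}" and "k < card I"
  shows "row (sel m I) k = unit_vec m (sorted_list_of_set I ! k)"
    and "sorted_list_of_set I ! k \<in> I"
proof -
  have fin: "finite I" using assms(1) finite_subset by blast
  have len: "k < length (sorted_list_of_set I)" using assms(2) fin by simp
  then show "row (sel m I) k = unit_vec m (sorted_list_of_set I ! k)"
    unfolding sel_def by (subst mat_of_rows_row) auto
  have "sorted_list_of_set I ! k \<in> set (sorted_list_of_set I)" using len by (rule nth_mem)
  then show "sorted_list_of_set I ! k \<in> I" using fin by simp
qed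

lemma sel_mult_vec_eq_0:
  assumes I: "I \<subseteq> {0..<m}" and v: "v \<in> carrier_vec m" and zero: "\<And>i. i \<in> I \<Longrightarrow> v $ i = 0"
  shows "sel m I *\<^sub>v v = 0\<^sub>v (card I)"
proof (rule eq_vecI)
  have fin: "finite I" using I finite_subset by blast
  show "dim_vec (sel m I *\<^sub>v v) = dim_vec (0\<^sub>v (card I))" using sel_carrier[OF fin, of m] by auto
  fix k assume "k < dim_vec (0\<^sub>v (card I))"
  then have k: "k < card I" by simp
  have "(sel m I *\<^sub>v v) $ k = unit_vec m (sorted_list_of_set I ! k) \<bullet> v"
    using k row_sel(1)[OF I k] sel_carrier[OF fin, of m] by auto
  also have "\<dots> = 0" using row_sel(2)[OF I k] I v zero by (subst scalar_prod_left_unit) auto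
  finally show "(sel m I *\<^sub>v v) $ k = 0\<^sub>v (card I) $ k" using k by simp
qed

lemma sel_mult_transpose:
  assumes I: "I \<subseteq> {0..<m}"
  shows "sel m I * transpose_mat (sel m I) = 1\<^sub>m (card I)"
proof (rule eq_matI)
  have fin: "finite I" using I finite_subset by blast
  note P = carrier_matD[OF sel_carrier[OF fin, of m]]
  show "dim_row (sel m I * transpose_mat (sel m I)) = dim_row (1\<^sub>m (card I))"
    and "dim_col (sel m I * transpose_mat (sel m I)) = dim_col (1\<^sub>m (card I))" using P by auto
  fix a b assume "a < dim_row (1\<^sub>m (card I))" "b < dim_col (1\<^sub>m (card I))"
  then have a: "a < card I" and b: "b < card I" by auto
  let ?s = "sorted_list_of_set I"
  have "(sel m I * transpose_mat (sel m I)) $$ (a, b) = unit_vec m (?s ! a) \<bullet> unit_vec m (?s ! b)"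
    using a b P row_sel(1)[OF I] by simp
  also have "\<dots> = unit_vec m (?s ! b) $ (?s ! a)"
    using row_sel(2)[OF I a] I by (subst scalar_prod_left_unit) auto
  also have "\<dots> = (if a = b then 1 else 0)"
    using row_sel(2)[OF I a] I a b nth_eq_iff_index_eq[of ?s a b] by (auto simp: unit_vec_def)
  finally show "(sel m I * transpose_mat (sel m I)) $$ (a, b) = 1\<^sub>m (card I) $$ (a, b)"
    using a b by simp
qed

text \<open>
  The factor exists because every sensor of \<open>J\<close> has a position in the enumeration of \<open>I\<close>, and it
  is unique because the rows of \<open>sel m I\<close> are orthonormal, so that its transpose is a right inverse.
\<close>

lemma resel_spec:
  assumes J: "J \<subseteq> I" and I: "I \<subseteq> {0..<m}"
  shows "resel m J I \<in> carrier_mat (card J) (card I)" and "sel m J = resel m J I * sel m I"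
proof -
  have finI: "finite I" using I finite_subset by blast
  have finJ: "finite J" using J finI finite_subset by blast
  have Jm: "J \<subseteq> {0..<m}" using I J by blast
  note PI = sel_carrier[OF finI, of m] and PJ = sel_carrier[OF finJ, of m]
  let ?s = "sorted_list_of_set I" and ?r = "sorted_list_of_set J"
  have "\<exists>b<card I. ?s ! b = ?r ! a" if "a < card J" for a
  proof -
    have "?r ! a \<in> set ?s" using row_sel(2)[OF Jm that] J finI by auto
    then obtain b where "b < length ?s" "?s ! b = ?r ! a" unfolding in_set_conv_nth by blast
    then show ?thesis using finI by auto
  qed
  then obtain pos where pos: "\<And>a. a < card J \<Longrightarrow> pos a < card I"
    and at_pos: "\<And>a. a < card J \<Longrightarrow> ?s ! pos a = ?r ! a" by metis
  define Q :: "real mat" where "Q = mat_of_rows (card I) (map (\<lambda>a. unit_vec (card I) (pos a)) [0..<card J])"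
  have Q: "Q \<in> carrier_mat (card J) (card I)"
    unfolding Q_def using mat_of_rows_carrier(1) by (metis length_map length_upt minus_nat.diff_0)
  have row_Q: "row Q a = unit_vec (card I) (pos a)" if "a < card J" for a
    unfolding Q_def using that by (subst mat_of_rows_row) auto
  have fact: "sel m J = Q * sel m I"
  proof (rule eq_rowI)
    fix a assume "a < dim_row (Q * sel m I)"
    then have a: "a < card J" using Q by simp
    have "row (Q * sel m I) a = row (sel m I) (pos a)"
    proof (rule eq_vecI)
      fix c assume "c < dim_vec (row (sel m I) (pos a))"
      then have c: "c < m" using PI by simp
      have "row (Q * sel m I) a $ c = unit_vec (card I) (pos a) \<bullet> col (sel m I) c"
        using a c Q PI row_Q[OF a] by simp
      also have "\<dots> = col (sel m I) c $ pos a"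
        using pos[OF a] PI by (subst scalar_prod_left_unit) (auto intro!: carrier_vecI)
      also have "\<dots> = row (sel m I) (pos a) $ c" using pos[OF a] PI c by simp
      finally show "row (Q * sel m I) a $ c = row (sel m I) (pos a) $ c" .
    qed (use Q PI in auto)
    also have "\<dots> = row (sel m J) a"
      using row_sel(1)[OF I pos[OF a]] row_sel(1)[OF Jm a] at_pos[OF a] by simp
    finally show "row (sel m J) a = row (Q * sel m I) a" by simp
  qed (use Q PI PJ in auto)
  have unique: "R = Q" if R: "R \<in> carrier_mat (card J) (card I)" "sel m J = R * sel m I" for R
  proof -
    have cancel: "S = (S * sel m I) * transpose_mat (sel m I)" if "S \<in> carrier_mat (card J) (card I)" for S
      using that PI sel_mult_transpose[OF I]
      by (subst assoc_mult_mat[OF that PI]) auto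
    have "R = sel m J * transpose_mat (sel m I)" using cancel[OF R(1)] R(2) by simp
    also have "\<dots> = Q" using cancel[OF Q] fact by simp
    finally show ?thesis .
  qed
  have "resel m J I = Q"
    unfolding resel_def by (rule the_equality) (rule conjI[OF Q fact], rule unique, auto)
  then show "resel m J I \<in> carrier_mat (card J) (card I)" and "sel m J = resel m J I * sel m I"
    by (simp_all only: Q flip: fact)
qed

section \<open>Local estimators\<close>

lemma append_cols_mult_vec:
  assumes M: "M \<in> carrier_mat r a" and N: "N \<in> carrier_mat r b"
    and u: "u \<in> carrier_vec a" and v: "v \<in> carrier_vec b"
  shows "append_cols M N *\<^sub>v (u @\<^sub>v v) = M *\<^sub>v u + N *\<^sub>v v"
proof -
  have "append_cols M N *\<^sub>v (u @\<^sub>v v)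
      = (M *\<^sub>v u + N *\<^sub>v v) @\<^sub>v (0\<^sub>m 0 a *\<^sub>v u + 0\<^sub>m 0 b *\<^sub>v v)"
    unfolding append_cols_def using M N u v by (subst four_block_mat_mult_vec) auto
  also have "\<dots> = M *\<^sub>v u + N *\<^sub>v v" using M N by (intro eq_vecI) auto
  finally show ?thesis .
qed

locale observer_bank =
  fixes n l m \<rho> :: nat and A B C D :: "real mat" and G :: lti and K :: "nat set \<Rightarrow> real mat"
  assumes A: "A \<in> carrier_mat n n" and B: "B \<in> carrier_mat n l"
    and C: "C \<in> carrier_mat m n" and D: "D \<in> carrier_mat m l"
    and G: "G = LTI A B C D"
    and K: "\<And>I. I \<in> sensor_sets m \<rho> \<Longrightarrow> K I \<in> carrier_mat n (m - \<rho>)"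
    and stable: "\<And>I. I \<in> sensor_sets m \<rho> \<Longrightarrow> strictly_stable (A + K I * selC G I)"
    and detectable: "chi_detectable (2 * \<rho>) G"
begin

lemma sensor_setD:
  assumes "I \<in> sensor_sets m \<rho>"
  shows "I \<subseteq> {0..<m}" and "finite I" and "card I = m - \<rho>"
  using assms finite_subset[of I "{0..<m}"] by (auto simp: sensor_sets_def)

lemma finite_sensor_sets [simp]: "finite (sensor_sets m \<rho>)"
  by (rule finite_subset[of _ "Pow {0..<m}"]) (auto simp: sensor_sets_def)

lemma selC_carrier: "finite J \<Longrightarrow> selC G J \<in> carrier_mat (card J) n"
  and selD_carrier: "finite J \<Longrightarrow> selD G J \<in> carrier_mat (card J) l"
  using C D by (auto simp: selC_def selD_def G intro!: mult_carrier_mat[of _ _ m])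

lemma lti_carrier_G: "lti_carrier n l m G"
  using A B C D by (simp add: lti_carrier_def G)

lemma measurement_carrier:
  assumes "a \<in> signals m"
  shows "measurement G w a t \<in> carrier_vec m"
  using assms lti_output_carrier[OF lti_carrier_G, of w t] by (auto simp: measurement_def signals_def)

lemma selC_sensor_set: "I \<in> sensor_sets m \<rho> \<Longrightarrow> selC G I \<in> carrier_mat (m - \<rho>) n"
  and selD_sensor_set: "I \<in> sensor_sets m \<rho> \<Longrightarrow> selD G I \<in> carrier_mat (m - \<rho>) l"
  using selC_carrier[of I] selD_carrier[of I] sensor_setD[of I] by auto

lemma local_est_carrier:
  assumes "I \<in> sensor_sets m \<rho>"
  shows "local_est G K I y t \<in> carrier_vec n"
  by (rule carrier_vecI, cases t) (use A K[OF assms] in \<open>auto simp: G\<close>)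

lemma residual_carrier:
  assumes "I \<in> sensor_sets m \<rho>"
  shows "residual G K I y t \<in> carrier_vec (m - \<rho>)"
  by (rule carrier_vecI) (use selC_sensor_set[OF assms] in \<open>auto simp: residual_def G\<close>)

lemma local_est_Suc:
  "local_est G K I y (Suc t) = A *\<^sub>v local_est G K I y t - K I *\<^sub>v residual G K I y t"
  by (simp add: residual_def G)

lemma lti_carrier_sysE: "I \<in> sensor_sets m \<rho> \<Longrightarrow> lti_carrier n l n (sysE G K I)"
  and lti_carrier_sysF: "I \<in> sensor_sets m \<rho> \<Longrightarrow> lti_carrier n l (m - \<rho>) (sysF G K I)"
  using A B C D K[of I] selC_sensor_set[of I] selD_sensor_set[of I]
  by (auto simp: lti_carrier_def sysE_def sysF_def G)

text \<open>
  If none of the sensors in \<open>I\<close> is attacked, then the error of the local estimator obeys the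
  recursion with the state matrix \<open>A + K I * selC G I\<close> and is driven by the disturbance only.
\<close>

lemma unattacked_estimator:
  assumes I: "I \<in> sensor_sets m \<rho>" and w: "w \<in> signals l" and a: "a \<in> signals m"
    and unattacked: "\<And>t. sel m I *\<^sub>v a t = 0\<^sub>v (m - \<rho>)"
  shows "lti_state G w t - local_est G K I (measurement G w a) t = lti_output (sysE G K I) w t"
    and "residual G K I (measurement G w a) t = lti_output (sysF G K I) w t"
proof -
  let ?y = "measurement G w a" and ?x = "lti_state G w" and ?z = "local_est G K I (measurement G w a)"
  let ?r = "residual G K I (measurement G w a)" and ?e = "lti_state (sysE G K I) w"
  note finI = sensor_setD(2)[OF I] and cardI = sensor_setD(3)[OF I]
  have P: "sel m I \<in> carrier_mat (m - \<rho>) m" using sel_carrier[OF finI, of m] cardI by simp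
  note PC = selC_sensor_set[OF I] and PD = selD_sensor_set[OF I]
  have x: "?x t \<in> carrier_vec n" for t by (rule lti_state_carrier[OF lti_carrier_G])
  have y: "?y t \<in> carrier_vec m" for t by (rule measurement_carrier[OF a])
  have z: "?z t \<in> carrier_vec n" for t by (rule local_est_carrier[OF I])
  have wt: "w t \<in> carrier_vec l" and at: "a t \<in> carrier_vec m" for t using w a by (auto simp: signals_def)
  have res: "?r t = selC G I *\<^sub>v (?x t - ?z t) + selD G I *\<^sub>v w t" for t
  proof -
    have Cx: "C *\<^sub>v ?x t \<in> carrier_vec m" and Dw: "D *\<^sub>v w t \<in> carrier_vec m"
      using C D x wt by auto
    have PCx: "sel m I *\<^sub>v (C *\<^sub>v ?x t) \<in> carrier_vec (m - \<rho>)"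
      and PDw: "sel m I *\<^sub>v (D *\<^sub>v w t) \<in> carrier_vec (m - \<rho>)"
      using P Cx Dw by auto
    have "sel m I *\<^sub>v ?y t = sel m I *\<^sub>v (C *\<^sub>v ?x t) + sel m I *\<^sub>v (D *\<^sub>v w t) + sel m I *\<^sub>v a t"
      using mult_add_distrib_mat_vec[OF P, of "C *\<^sub>v ?x t + D *\<^sub>v w t" "a t"]
        mult_add_distrib_mat_vec[OF P Cx Dw] Cx Dw at
      by (simp add: measurement_def lti_output_def G)
    also have "\<dots> = selC G I *\<^sub>v ?x t + selD G I *\<^sub>v w t"
      using assoc_mult_mat_vec[OF P C x] assoc_mult_mat_vec[OF P D wt] unattacked C D
        right_zero_vec[OF add_carrier_vec[OF PCx PDw]]
      by (simp add: selC_def selD_def G)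
    finally have "?r t = selC G I *\<^sub>v ?x t + selD G I *\<^sub>v w t - selC G I *\<^sub>v ?z t"
      using C by (simp add: residual_def G)
    moreover have "selC G I *\<^sub>v (?x t - ?z t) = selC G I *\<^sub>v ?x t - selC G I *\<^sub>v ?z t"
      by (rule mult_minus_distrib_mat_vec[OF PC x z])
    ultimately show ?thesis
      using PC PD by (auto simp del: index_mult_mat_vec)
  qed
  have err: "?x t - ?z t = ?e t" for t
  proof (induction t)
    case 0
    then show ?case using A K[OF I] by (auto simp: G sysE_def)
  next
    case (Suc t)
    have e: "?e t \<in> carrier_vec n" by (rule lti_state_carrier[OF lti_carrier_sysE[OF I]])
    have KC: "K I * selC G I \<in> carrier_mat n n" and KD: "K I * selD G I \<in> carrier_mat n l"
      using K[OF I] PC PD by auto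
    have PCe: "selC G I *\<^sub>v ?e t \<in> carrier_vec (m - \<rho>)" and PDw: "selD G I *\<^sub>v w t \<in> carrier_vec (m - \<rho>)"
      using PC PD e wt by auto
    have r: "?r t = selC G I *\<^sub>v ?e t + selD G I *\<^sub>v w t" using res[of t] Suc by simp
    have Ae: "A *\<^sub>v ?e t = A *\<^sub>v ?x t - A *\<^sub>v ?z t"
      using mult_minus_distrib_mat_vec[OF A x[of t] z[of t]] Suc by simp
    have Kr: "K I *\<^sub>v ?r t = (K I * selC G I) *\<^sub>v ?e t + (K I * selD G I) *\<^sub>v w t"
      unfolding r mult_add_distrib_mat_vec[OF K[OF I] PCe PDw]
      using assoc_mult_mat_vec[OF K[OF I] PC e] assoc_mult_mat_vec[OF K[OF I] PD wt] by simp
    have "?e (Suc t) = (A *\<^sub>v ?e t + (K I * selC G I) *\<^sub>v ?e t)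
        + (B *\<^sub>v w t + (K I * selD G I) *\<^sub>v w t)"
      using add_mult_distrib_mat_vec[OF A KC e] add_mult_distrib_mat_vec[OF B KD wt]
      by (simp add: sysE_def G)
    also have "\<dots> = (A *\<^sub>v ?x t + B *\<^sub>v w t) - (A *\<^sub>v ?z t - K I *\<^sub>v ?r t)"
      unfolding Kr Ae using A B K[OF I]
      by (intro eq_vecI) (auto simp del: index_mult_mat_vec)
    also have "\<dots> = ?x (Suc t) - ?z (Suc t)"
      using local_est_Suc by (simp add: G)
    finally show ?case by simp
  qed
  show "?x t - ?z t = lti_output (sysE G K I) w t"
    using err[of t] lti_state_carrier[OF lti_carrier_sysE[OF I], of w t] wt A B
    by (auto simp: lti_output_def sysE_def G)
  have "lti_state (sysF G K I) w t = ?e t"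
    by (induction t) (auto simp: sysE_def sysF_def)
  then show "?r t = lti_output (sysF G K I) w t"
    using res[of t] err[of t] by (simp add: lti_output_def sysF_def)
qed

text \<open>
  The system whose gain occurs in \<open>alpha\<close>. Its state will be the difference of two local estimates
  whose sensor sets have the intersection \<open>J\<close>.
\<close>

definition disagreement_system :: "nat set \<Rightarrow> real mat \<Rightarrow> lti" where
  "disagreement_system J L = LTI (A + L * selC G J) (append_cols (1\<^sub>m n) L) (1\<^sub>m n) (0\<^sub>m n (n + card J))"

text \<open>
  The matrix whose norm occurs in \<open>beta\<close>. It maps the residual of estimator \<open>I\<close> to an input of
  the disagreement system.
\<close>

definition injection :: "nat set \<Rightarrow> nat set \<Rightarrow> real mat" where
  "injection J I = - K I @\<^sub>r resel m J I"

lemma lti_carrier_disagreement_system: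
  assumes "finite J" and "L \<in> carrier_mat n (card J)"
  shows "lti_carrier n (n + card J) n (disagreement_system J L)"
  using assms A selC_carrier[of J]
  by (auto simp: lti_carrier_def disagreement_system_def append_cols_def)

lemma injection_carrier:
  assumes "I \<in> sensor_sets m \<rho>" and "J \<subseteq> I"
  shows "injection J I \<in> carrier_mat (n + card J) (m - \<rho>)"
  using K[OF assms(1)] resel_spec(1)[OF assms(2) sensor_setD(1)[OF assms(1)]] sensor_setD(3)[OF assms(1)]
  by (auto simp: injection_def)

text \<open>
  On the common sensors \<open>J\<close>, the residual of estimator \<open>I\<close> is \<open>y\<^sub>J - C\<^sub>J z\<close>, where \<open>z\<close> is
  the local estimate. Adding and subtracting \<open>L\<close> times this vector turns the update of \<open>z\<close>
  into an observer with an arbitrary gain \<open>L\<close>, driven by the residual. The term in \<open>y\<close> that is left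
  over depends on \<open>J\<close> and \<open>L\<close> but not on \<open>I\<close>.
\<close>

lemma local_est_as_common_observer:
  assumes I: "I \<in> sensor_sets m \<rho>" and J: "J \<subseteq> I" and L: "L \<in> carrier_mat n (card J)"
    and y: "\<And>t. y t \<in> carrier_vec m"
  shows "local_est G K I y (Suc t) =
    (A + L * selC G J) *\<^sub>v local_est G K I y t
    + append_cols (1\<^sub>m n) L *\<^sub>v (injection J I *\<^sub>v residual G K I y t)
    - L *\<^sub>v (sel m J *\<^sub>v y t)"
proof -
  let ?z = "local_est G K I y t" and ?r = "residual G K I y t" and ?R = "resel m J I"
  note Im = sensor_setD(1)[OF I] and finI = sensor_setD(2)[OF I] and cardI = sensor_setD(3)[OF I]
  have finJ: "finite J" using J finI finite_subset by blast
  have R: "?R \<in> carrier_mat (card J) (m - \<rho>)" and PJ: "sel m J = ?R * sel m I"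
    using resel_spec[OF J Im] cardI by auto
  have P: "sel m I \<in> carrier_mat (m - \<rho>) m" using sel_carrier[OF finI, of m] cardI by simp
  note CI = selC_sensor_set[OF I]
  have CJ: "selC G J \<in> carrier_mat (card J) n" by (rule selC_carrier[OF finJ])
  have z: "?z \<in> carrier_vec n" by (rule local_est_carrier[OF I])
  have r: "?r \<in> carrier_vec (m - \<rho>)" by (rule residual_carrier[OF I])
  have Kr: "K I *\<^sub>v ?r \<in> carrier_vec n" using K[OF I] r by auto
  have CJ_eq: "selC G J = ?R * selC G I"
    using assoc_mult_mat[OF R P C] C by (simp add: selC_def G PJ)
  have r_def: "?r = sel m I *\<^sub>v y t - selC G I *\<^sub>v ?z" using C by (simp add: residual_def G)
  have Rr: "?R *\<^sub>v ?r = sel m J *\<^sub>v y t - selC G J *\<^sub>v ?z"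
    unfolding r_def CJ_eq PJ
    using mult_minus_distrib_mat_vec[OF R, of "sel m I *\<^sub>v y t" "selC G I *\<^sub>v ?z"]
      assoc_mult_mat_vec[OF R P y] assoc_mult_mat_vec[OF R CI z] P CI y z by simp
  have LRr: "L *\<^sub>v (?R *\<^sub>v ?r) = L *\<^sub>v (sel m J *\<^sub>v y t) - (L * selC G J) *\<^sub>v ?z"
    unfolding Rr using mult_minus_distrib_mat_vec[OF L, of "sel m J *\<^sub>v y t" "selC G J *\<^sub>v ?z"]
      assoc_mult_mat_vec[OF L CJ z] sel_carrier[OF finJ, of m] CJ y z by simp
  have "injection J I *\<^sub>v ?r = (- K I *\<^sub>v ?r) @\<^sub>v (?R *\<^sub>v ?r)"
    unfolding injection_def using K[OF I] R r by (intro mat_mult_append[of _ n "m - \<rho>"]) auto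
  then have "append_cols (1\<^sub>m n) L *\<^sub>v (injection J I *\<^sub>v ?r) = - K I *\<^sub>v ?r + L *\<^sub>v (?R *\<^sub>v ?r)"
    using append_cols_mult_vec[OF one_carrier_mat L, of "- K I *\<^sub>v ?r" "?R *\<^sub>v ?r"] K[OF I] R r by simp
  also have "- K I *\<^sub>v ?r = - (K I *\<^sub>v ?r)"
    using K[OF I] r by (intro eq_vecI) auto
  finally have inj: "append_cols (1\<^sub>m n) L *\<^sub>v (injection J I *\<^sub>v ?r)
    = - (K I *\<^sub>v ?r) + (L *\<^sub>v (sel m J *\<^sub>v y t) - (L * selC G J) *\<^sub>v ?z)"
    unfolding LRr .
  have "(A + L * selC G J) *\<^sub>v ?z = A *\<^sub>v ?z + (L * selC G J) *\<^sub>v ?z"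
    using L CJ by (intro add_mult_distrib_mat_vec[OF A _ z]) auto
  then show ?thesis
    unfolding inj local_est_Suc using A K[OF I] L
    by (intro eq_vecI) (auto simp del: index_mult_mat_vec)
qed

text \<open>
  Two estimators that are rewritten as observers with the same gain on their common sensors see the
  same measurement there. It cancels in the difference, attack included.
\<close>

lemma local_est_disagreement:
  assumes I: "I \<in> sensor_sets m \<rho>" and J: "J \<in> sensor_sets m \<rho>"
    and L: "L \<in> carrier_mat n (card (I \<inter> J))" and y: "\<And>t. y t \<in> carrier_vec m"
  shows "local_est G K I y t - local_est G K J y t =
    lti_output (disagreement_system (I \<inter> J) L)
      (\<lambda>t. injection (I \<inter> J) I *\<^sub>v residual G K I y t - injection (I \<inter> J) J *\<^sub>v residual G K J y t) t"
proof -
  let ?Q = "I \<inter> J" and ?z = "\<lambda>I. local_est G K I y" and ?v = "\<lambda>J. injection (I \<inter> J) J *\<^sub>v residual G K J y t"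
  let ?u = "\<lambda>t. injection (I \<inter> J) I *\<^sub>v residual G K I y t - injection (I \<inter> J) J *\<^sub>v residual G K J y t"
  let ?S = "disagreement_system (I \<inter> J) L"
  have finQ: "finite ?Q" using sensor_setD(2)[OF I] by simp
  have S: "lti_carrier n (n + card ?Q) n ?S" by (rule lti_carrier_disagreement_system[OF finQ L])
  have N: "append_cols (1\<^sub>m n) L \<in> carrier_mat n (n + card ?Q)"
    and F: "A + L * selC G ?Q \<in> carrier_mat n n"
    using S by (auto simp: lti_carrier_def disagreement_system_def)
  have z: "?z I t \<in> carrier_vec n" "?z J t \<in> carrier_vec n" for t
    by (rule local_est_carrier[OF I] local_est_carrier[OF J])+
  have v: "injection ?Q I *\<^sub>v residual G K I y t \<in> carrier_vec (n + card ?Q)"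
    "injection ?Q J *\<^sub>v residual G K J y t \<in> carrier_vec (n + card ?Q)" for t
    using injection_carrier[OF I, of ?Q] injection_carrier[OF J, of ?Q]
      residual_carrier[OF I] residual_carrier[OF J] by (auto intro!: mult_mat_vec_carrier)
  have state: "lti_state ?S ?u t = ?z I t - ?z J t" for t
  proof (induction t)
    case 0
    have "state_dim ?S = n" using S by (auto simp: lti_carrier_def)
    moreover have "state_dim G = n" using A by (simp add: G)
    ultimately show ?case by simp
  next
    case (Suc t)
    have "lti_state ?S ?u (Suc t)
        = (A + L * selC G ?Q) *\<^sub>v (?z I t - ?z J t) + append_cols (1\<^sub>m n) L *\<^sub>v ?u t"
      using Suc by (simp add: disagreement_system_def)
    also have "\<dots> = ((A + L * selC G ?Q) *\<^sub>v ?z I t - (A + L * selC G ?Q) *\<^sub>v ?z J t)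
        + (append_cols (1\<^sub>m n) L *\<^sub>v (injection ?Q I *\<^sub>v residual G K I y t)
          - append_cols (1\<^sub>m n) L *\<^sub>v (injection ?Q J *\<^sub>v residual G K J y t))"
      unfolding mult_minus_distrib_mat_vec[OF F z(1) z(2)] mult_minus_distrib_mat_vec[OF N v(1) v(2)] ..
    also have "\<dots> = ?z I (Suc t) - ?z J (Suc t)"
      unfolding local_est_as_common_observer[OF I Int_lower1 L y]
        local_est_as_common_observer[OF J Int_lower2 L y]
      using F N L by (intro eq_vecI) (auto simp del: index_mult_mat_vec)
    finally show ?case .
  qed
  show ?thesis
    using state[of t] z[of t] v[of t] by (auto simp: lti_output_def disagreement_system_def)
qed

text \<open>
  Two sets of \<open>m - \<rho>\<close> sensors share at least \<open>m - 2\<rho>\<close> sensors, and a gain for some of the common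
  sensors is also a gain for all of them, with zero columns for the others.
\<close>

lemma exists_common_gain:
  assumes I: "I \<in> sensor_sets m \<rho>" and J: "J \<in> sensor_sets m \<rho>"
  obtains L where "L \<in> carrier_mat n (card (I \<inter> J))" and "strictly_stable (A + L * selC G (I \<inter> J))"
proof -
  let ?Q = "I \<inter> J"
  note Im = sensor_setD[OF I] and Jm = sensor_setD[OF J]
  have Qm: "?Q \<subseteq> {0..<m}" using Im by blast
  have "card (I \<union> J) \<le> m" using card_mono[of "{0..<m}" "I \<union> J"] Im Jm by simp
  then have "m - 2 * \<rho> \<le> card ?Q" using card_Un_Int[of I J] Im Jm by linarith
  then obtain S where S: "S \<subseteq> ?Q" "card S = m - 2 * \<rho>" "finite S"
    by (rule obtain_subset_with_card_n)
  have "detectable A (selC G S)"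
    using detectable S Qm C by (auto simp: chi_detectable_def G)
  then obtain H where H: "H \<in> carrier_mat n (card S)" "strictly_stable (A + H * selC G S)"
    using A selC_carrier[OF S(3)] by (auto simp: detectable_def)
  have R: "resel m S ?Q \<in> carrier_mat (card S) (card ?Q)" and PS: "sel m S = resel m S ?Q * sel m ?Q"
    using resel_spec[OF S(1) Qm] by auto
  have Q: "sel m ?Q \<in> carrier_mat (card ?Q) m" using Im(2) by simp
  have "selC G S = resel m S ?Q * selC G ?Q"
    using assoc_mult_mat[OF R Q C] C by (simp add: selC_def G PS)
  then have "H * selC G S = (H * resel m S ?Q) * selC G ?Q"
    using assoc_mult_mat[OF H(1) R selC_carrier] Im(2) by simp
  then show ?thesis using H R by (intro that[of "H * resel m S ?Q"]) auto
qed

end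

section \<open>The energy of averages over a shrinking family\<close>

text \<open>
  Think of the members of \<open>S\<close>, together with one immortal further member of rank 1, as ranked by
  the time at which they die: the first to die has the highest rank. A member of rank \<open>k\<close> gets the
  weight \<open>c = 1 / (2 * k - 1)\<close>. When \<open>N\<close> members including the immortal one are alive, they are those
  of rank at most \<open>N\<close>, and the reciprocals of their weights sum up to at most the sum of the
  first \<open>N\<close> odd numbers, \<open>N\<^sup>2\<close>. The weights themselves are summed by
  \<open>2 / (2 * k - 1) \<le> ln k - ln (k - 1)\<close>, whose telescoping sum is half of the logarithm.
  
  The induction adds members in the order of increasing rank, so that the new member dies first.
  Its rank is \<open>card S + 2\<close>.
\<close>

lemma survivor_weights:
  fixes alive :: "nat \<Rightarrow> 'a \<Rightarrow> bool"
  assumes "finite S" and dies: "\<And>s t J. s \<le> t \<Longrightarrow> alive t J \<Longrightarrow> alive s J"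
  shows "\<exists>c. (\<forall>J\<in>S. 0 < c J) \<and> (\<Sum>J\<in>S. c J) \<le> ln (1 + real (card S)) / 2
    \<and> (\<forall>t\<le>T. (\<Sum>J\<in>{J \<in> S. alive t J}. 1 / c J) \<le> (1 + real (card {J \<in> S. alive t J}))\<^sup>2)"
  using assms(1)
proof (induction S rule: finite_ranking_induct[where f = "\<lambda>J. - int (card {t. t \<le> T \<and> alive t J})"])
  case empty
  then show ?case by simp
next
  case (insert x S)
  show ?case
  proof (cases "x \<in> S")
    case True
    then show ?thesis using insert.IH by (simp add: insert_absorb)
  next
    case False
    from insert.IH obtain c where c: "\<forall>J\<in>S. 0 < c J" "(\<Sum>J\<in>S. c J) \<le> ln (1 + real (card S)) / 2"
      "\<And>t. t \<le> T \<Longrightarrow> (\<Sum>J\<in>{J \<in> S. alive t J}. 1 / c J) \<le> (1 + real (card {J \<in> S. alive t J}))\<^sup>2"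
      by blast
    define N where "N = real (card S)"
    define c' where "c' = c(x := 1 / (2 * N + 3))"
    have N: "0 \<le> N" by (simp add: N_def)
    have c'_S: "c' J = c J" if "J \<in> S" for J using that False by (auto simp: c'_def)
    have step: "1 / (2 * N + 3) \<le> (ln (N + 2) - ln (N + 1)) / 2"
      using ln_inverse_approx_ge[of "N + 1" "N + 2"] N by (simp add: add_ac)
    have "(\<Sum>J\<in>insert x S. c' J) = 1 / (2 * N + 3) + (\<Sum>J\<in>S. c J)"
      using False \<open>finite S\<close> c'_S by (simp add: c'_def)
    also have "\<dots> \<le> ln (1 + real (card (insert x S))) / 2"
      using step c(2) False \<open>finite S\<close> by (simp add: N_def add_ac diff_divide_distrib)
    finally have total: "(\<Sum>J\<in>insert x S. c' J) \<le> ln (1 + real (card (insert x S))) / 2" .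
    have "(\<Sum>J\<in>{J \<in> insert x S. alive t J}. 1 / c' J) \<le> (1 + real (card {J \<in> insert x S. alive t J}))\<^sup>2"
      if t: "t \<le> T" for t
    proof (cases "alive t x")
      case True
      have "alive t y" if y: "y \<in> S" for y
      proof (rule ccontr)
        assume "\<not> alive t y"
        then have "{s. s \<le> T \<and> alive s y} \<subseteq> {..<t}" using dies by (metis (mono_tags, lifting) lessThan_iff mem_Collect_eq not_less subsetI)
        then have "card {s. s \<le> T \<and> alive s y} \<le> card {..<t}" by (rule card_mono[rotated]) simp
        moreover have "{..t} \<subseteq> {s. s \<le> T \<and> alive s x}" using dies[OF _ True] t by auto
        then have "card {..t} \<le> card {s. s \<le> T \<and> alive s x}" by (rule card_mono[rotated]) simp
        ultimately show False using insert.hyps(2)[OF y] by simp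
      qed
      then have S: "{J \<in> S. alive t J} = S" by blast
      then have all: "{J \<in> insert x S. alive t J} = insert x S" using True by blast
      have "(\<Sum>J\<in>insert x S. 1 / c' J) = (2 * N + 3) + (\<Sum>J\<in>S. 1 / c J)"
        using False \<open>finite S\<close> c'_S by (simp add: c'_def)
      also have "\<dots> \<le> (2 * N + 3) + (1 + N)\<^sup>2" using c(3)[OF t] by (simp add: S N_def)
      also have "\<dots> = (1 + real (card (insert x S)))\<^sup>2"
        using False \<open>finite S\<close> by (simp add: N_def power2_eq_square algebra_simps)
      finally show ?thesis unfolding all .
    next
      case False
      then have "{J \<in> insert x S. alive t J} = {J \<in> S. alive t J}" by blast
      moreover have "(\<Sum>J\<in>{J \<in> S. alive t J}. 1 / c' J) = (\<Sum>J\<in>{J \<in> S. alive t J}. 1 / c J)"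
        using c'_S by (intro sum.cong) auto
      ultimately show ?thesis using c(3)[OF t] by simp
    qed
    moreover have "\<forall>J\<in>insert x S. 0 < c' J" using c(1) c'_S N by (auto simp: c'_def)
    ultimately show ?thesis using total by blast
  qed
qed

text \<open>
  The Cauchy-Schwarz inequality with the weights of \<open>survivor_weights\<close> bounds the square of each
  average by the weighted sum of the squares, because the factor with the reciprocal weights is at
  most the square of the denominator. Summation over time then charges to each member its
  own energy, taken over its lifetime only. The denominators are by one larger than the number of
  summands, because one more member of the averaged family contributes zero.
\<close>

lemma average_energy_le:
  fixes \<delta> :: "'a \<Rightarrow> nat \<Rightarrow> nat \<Rightarrow> real"
  assumes fin: "finite S" and dies: "\<And>s t J. s \<le> t \<Longrightarrow> alive t J \<Longrightarrow> alive s J"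
    and energy: "\<And>J. J \<in> S \<Longrightarrow> (\<Sum>t\<in>{t. t \<le> T \<and> alive t J}. \<Sum>i<n. (\<delta> J t i)\<^sup>2) \<le> d"
  shows "(\<Sum>t\<le>T. \<Sum>i<n. ((\<Sum>J\<in>{J \<in> S. alive t J}. \<delta> J t i) / (1 + real (card {J \<in> S. alive t J})))\<^sup>2)
    \<le> ln (1 + real (card S)) / 2 * d"
proof (cases "S = {}")
  case False
  obtain c where pos: "\<And>J. J \<in> S \<Longrightarrow> 0 < c J"
    and total: "(\<Sum>J\<in>S. c J) \<le> ln (1 + real (card S)) / 2"
    and inv: "\<And>t. t \<le> T \<Longrightarrow> (\<Sum>J\<in>{J \<in> S. alive t J}. 1 / c J) \<le> (1 + real (card {J \<in> S. alive t J}))\<^sup>2"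
  proof -
    have "\<exists>c. (\<forall>J\<in>S. 0 < c J) \<and> (\<Sum>J\<in>S. c J) \<le> ln (1 + real (card S)) / 2
      \<and> (\<forall>t\<le>T. (\<Sum>J\<in>{J \<in> S. alive t J}. 1 / c J) \<le> (1 + real (card {J \<in> S. alive t J}))\<^sup>2)"
      by (rule survivor_weights[OF fin]) (rule dies)
    then show ?thesis using that by blast
  qed
  have d: "0 \<le> d"
  proof -
    obtain J where "J \<in> S" using False by blast
    then show ?thesis by (intro order_trans[OF sum_nonneg energy]) (auto intro!: sum_nonneg)
  qed
  have pointwise: "((\<Sum>J\<in>{J \<in> S. alive t J}. \<delta> J t i) / (1 + real (card {J \<in> S. alive t J})))\<^sup>2
      \<le> (\<Sum>J\<in>{J \<in> S. alive t J}. c J * (\<delta> J t i)\<^sup>2)" if t: "t \<le> T" for t i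
  proof -
    let ?V = "{J \<in> S. alive t J}"
    have "\<delta> J t i = sqrt (1 / c J) * (sqrt (c J) * \<delta> J t i)" if "J \<in> S" for J
      using pos[OF that] by (simp add: real_sqrt_divide)
    then have "(\<Sum>J\<in>?V. \<delta> J t i)\<^sup>2 = (\<Sum>J\<in>?V. sqrt (1 / c J) * (sqrt (c J) * \<delta> J t i))\<^sup>2"
      by (intro arg_cong[where f = "\<lambda>x. x\<^sup>2"] sum.cong) auto
    also have "\<dots> \<le> (\<Sum>J\<in>?V. (sqrt (1 / c J))\<^sup>2) * (\<Sum>J\<in>?V. (sqrt (c J) * \<delta> J t i)\<^sup>2)"
      by (rule Cauchy_Schwarz_ineq_sum)
    also have "(\<Sum>J\<in>?V. (sqrt (1 / c J))\<^sup>2) = (\<Sum>J\<in>?V. 1 / c J)"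
      using pos by (intro sum.cong) (auto simp: less_imp_le)
    also have "(\<Sum>J\<in>?V. (sqrt (c J) * \<delta> J t i)\<^sup>2) = (\<Sum>J\<in>?V. c J * (\<delta> J t i)\<^sup>2)"
      using pos by (intro sum.cong) (auto simp: power_mult_distrib less_imp_le)
    also have "(\<Sum>J\<in>?V. 1 / c J) * (\<Sum>J\<in>?V. c J * (\<delta> J t i)\<^sup>2)
        \<le> (1 + real (card ?V))\<^sup>2 * (\<Sum>J\<in>?V. c J * (\<delta> J t i)\<^sup>2)"
      using pos by (intro mult_right_mono inv t sum_nonneg) (auto simp: less_imp_le)
    finally show ?thesis by (simp add: power_divide divide_le_eq mult.commute)
  qed
  have "(\<Sum>t\<le>T. \<Sum>i<n. ((\<Sum>J\<in>{J \<in> S. alive t J}. \<delta> J t i) / (1 + real (card {J \<in> S. alive t J})))\<^sup>2)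
      \<le> (\<Sum>t\<le>T. \<Sum>i<n. \<Sum>J\<in>{J \<in> S. alive t J}. c J * (\<delta> J t i)\<^sup>2)"
    by (intro sum_mono pointwise) auto
  also have "\<dots> = (\<Sum>t\<le>T. \<Sum>J\<in>S. if alive t J then c J * (\<Sum>i<n. (\<delta> J t i)\<^sup>2) else 0)"
  proof (intro sum.cong refl)
    fix t
    have "(\<Sum>i<n. \<Sum>J\<in>{J \<in> S. alive t J}. c J * (\<delta> J t i)\<^sup>2)
        = (\<Sum>J\<in>{J \<in> S. alive t J}. c J * (\<Sum>i<n. (\<delta> J t i)\<^sup>2))"
      by (subst sum.swap) (simp add: sum_distrib_left)
    then show "(\<Sum>i<n. \<Sum>J\<in>{J \<in> S. alive t J}. c J * (\<delta> J t i)\<^sup>2)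
        = (\<Sum>J\<in>S. if alive t J then c J * (\<Sum>i<n. (\<delta> J t i)\<^sup>2) else 0)"
      using fin by (simp add: sum.inter_filter)
  qed
  also have "\<dots> = (\<Sum>J\<in>S. \<Sum>t\<le>T. if alive t J then c J * (\<Sum>i<n. (\<delta> J t i)\<^sup>2) else 0)"
    by (rule sum.swap)
  also have "\<dots> = (\<Sum>J\<in>S. c J * (\<Sum>t\<in>{t. t \<le> T \<and> alive t J}. \<Sum>i<n. (\<delta> J t i)\<^sup>2))"
  proof (intro sum.cong refl)
    fix J
    have "{t. t \<le> T \<and> alive t J} = {t \<in> {..T}. alive t J}" by auto
    then show "(\<Sum>t\<le>T. if alive t J then c J * (\<Sum>i<n. (\<delta> J t i)\<^sup>2) else 0)
        = c J * (\<Sum>t\<in>{t. t \<le> T \<and> alive t J}. \<Sum>i<n. (\<delta> J t i)\<^sup>2)"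
      by (simp add: sum.inter_filter sum_distrib_left flip: sum.inter_filter)
  qed
  also have "\<dots> \<le> (\<Sum>J\<in>S. c J * d)"
    using pos energy by (intro sum_mono mult_left_mono) (auto simp: less_imp_le)
  also have "\<dots> \<le> ln (1 + real (card S)) / 2 * d"
    using mult_right_mono[OF total d] by (simp add: sum_distrib_right)
  finally show ?thesis .
qed simp


section \<open>The error of the global estimate\<close>

text \<open>
  The farther end point and \<open>c\<close> lie on opposite sides of the midpoint, or \<open>c\<close> is the midpoint.
  Since \<open>c\<close> does not pass the nearer end point, its distance from the midpoint is at most half of its
  distance from the farther one.
\<close>

lemma abs_minus_midpoint_le:
  fixes c lo hi :: real
  assumes "lo \<le> c" and "c \<le> hi"
  shows "\<bar>c - (lo + hi) / 2\<bar> \<le> max \<bar>c - lo\<bar> \<bar>c - hi\<bar> / 2"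
  using assms by (auto simp: abs_if max_def field_simps)

lemma ennreal_vnorm_Linf_le:
  assumes "\<And>i. i < dim_vec v \<Longrightarrow> ennreal \<bar>v $ i\<bar> \<le> c"
  shows "ennreal (vnorm Linf v) \<le> c"
proof (cases c)
  case (real r)
  then have "\<bar>v $ i\<bar> \<le> r" if "i < dim_vec v" for i
    using assms[OF that] by (simp add: ennreal_le_iff)
  then have "vnorm Linf v \<le> r" by (rule vnorm_Linf_le[OF real(1)])
  then show ?thesis unfolding real(2) by (rule ennreal_leI)
qed simp

lemma trunc_norm_L2_eq:
  assumes "\<And>t. x t \<in> carrier_vec d"
  shows "trunc_norm L2 T x = ennreal (sqrt (\<Sum>t\<le>T. \<Sum>i<d. (x t $ i)\<^sup>2))"
  using carrier_vecD[OF assms] by simp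

context observer_bank
begin

abbreviation valid :: "lp \<Rightarrow> lp \<Rightarrow> signal \<Rightarrow> nat \<Rightarrow> nat set set" where
  "valid p q y \<equiv> valid_sets G \<rho> K p q y"

lemma output_dim_G [simp]: "output_dim G = m" and input_dim_G [simp]: "input_dim G = l"
  and state_dim_G [simp]: "state_dim G = n"
  using A B C by (auto simp: G)

lemma valid_subset: "valid p q y t \<subseteq> sensor_sets m \<rho>"
  by (auto simp: valid_sets_def)

lemma finite_valid [simp]: "finite (valid p q y t)"
  using finite_subset[OF valid_subset] by simp

lemma valid_antimono:
  assumes "s \<le> t" and "I \<in> valid p q y t"
  shows "I \<in> valid p q y s"
  using assms order_trans[OF trunc_norm_mono_time] by (auto simp: valid_sets_def)

text \<open>
  The extreme estimates need not come from \<open>I\<close>, but every error term has to be charged to a pair that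
  contains \<open>I\<close>. By \<open>abs_minus_midpoint_le\<close>, half of the distance between the estimate \<open>I\<close> and one of
  the two extreme ones suffices.
\<close>

lemma est_error_Linf_le:
  assumes I: "I \<in> valid p Linf (measurement G w a) t"
    and E: "ennreal (vnorm Linf (lti_state G w t - local_est G K I (measurement G w a) t)) \<le> E"
    and \<Delta>: "\<And>J. J \<in> valid p Linf (measurement G w a) t \<Longrightarrow>
      ennreal (vnorm Linf (local_est G K I (measurement G w a) t
        - local_est G K J (measurement G w a) t)) \<le> \<Delta> J"
  shows "ennreal (vnorm Linf (est_error G \<rho> K p Linf w a t))
    \<le> (MAX J\<in>sensor_sets m \<rho>. E + ennreal (1 / 2) * \<Delta> J)"
proof (rule ennreal_vnorm_Linf_le)
  let ?y = "measurement G w a"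
  let ?V = "valid p Linf ?y t" and ?z = "\<lambda>J. local_est G K J ?y t" and ?x = "lti_state G w t"
  fix i assume "i < dim_vec (est_error G \<rho> K p Linf w a t)"
  then have i: "i < n" by (simp add: est_error_def global_est_def Let_def)
  have z: "?z J \<in> carrier_vec n" if "J \<in> ?V" for J
    using that valid_subset local_est_carrier by blast
  have x: "?x \<in> carrier_vec n" by (rule lti_state_carrier[OF lti_carrier_G])
  let ?lo = "MIN J\<in>?V. ?z J $ i" and ?hi = "MAX J\<in>?V. ?z J $ i"
  have ne: "(\<lambda>J. ?z J $ i) ` ?V \<noteq> {}" using I by blast
  obtain J where J: "J \<in> ?V" "?z J $ i = ?lo"
    using Min_in[OF _ ne] by auto
  obtain J' where J': "J' \<in> ?V" "?z J' $ i = ?hi"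
    using Max_in[OF _ ne] by auto
  have lo: "?lo \<le> ?z I $ i" and hi: "?z I $ i \<le> ?hi"
    using I by (auto intro!: Min_le Max_ge)
  have "\<exists>S\<in>?V. \<bar>?z I $ i - (?lo + ?hi) / 2\<bar> \<le> \<bar>?z I $ i - ?z S $ i\<bar> / 2"
    using abs_minus_midpoint_le[OF lo hi] J J' by (metis max_def)
  then obtain S where S: "S \<in> ?V" "\<bar>?z I $ i - (?lo + ?hi) / 2\<bar> \<le> \<bar>?z I $ i - ?z S $ i\<bar> / 2"
    by blast
  have est: "est_error G \<rho> K p Linf w a t $ i = ?x $ i - (?lo + ?hi) / 2"
    using i by (simp add: est_error_def global_est_def Let_def)
  have combine: "e \<le> \<alpha>' + 1 / 2 * \<beta>'" if "e \<le> \<alpha> + \<beta> / 2" "\<alpha> \<le> \<alpha>'" "\<beta> \<le> \<beta>'" for e \<alpha> \<alpha>' \<beta> \<beta>' :: real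
    using that by simp
  from est have "\<bar>est_error G \<rho> K p Linf w a t $ i\<bar> \<le> \<bar>?x $ i - ?z I $ i\<bar> + \<bar>?z I $ i - ?z S $ i\<bar> / 2"
    using S(2) by linarith
  moreover have "\<bar>?x $ i - ?z I $ i\<bar> \<le> vnorm Linf (?x - ?z I)"
    using abs_component_le_vnorm[of i "?x - ?z I" Linf] i x z[OF I] by (simp del: vnorm.simps)
  moreover have "\<bar>?z I $ i - ?z S $ i\<bar> \<le> vnorm Linf (?z I - ?z S)"
    using abs_component_le_vnorm[of i "?z I - ?z S" Linf] i z[OF I] z[OF S(1)] by (simp del: vnorm.simps)
  ultimately have "\<bar>est_error G \<rho> K p Linf w a t $ i\<bar> \<le> vnorm Linf (?x - ?z I) + 1 / 2 * vnorm Linf (?z I - ?z S)"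
    by (rule combine)
  then have "ennreal \<bar>est_error G \<rho> K p Linf w a t $ i\<bar>
      \<le> ennreal (vnorm Linf (?x - ?z I) + 1 / 2 * vnorm Linf (?z I - ?z S))" by (rule ennreal_leI)
  also have "\<dots> = ennreal (vnorm Linf (?x - ?z I)) + ennreal (1 / 2 * vnorm Linf (?z I - ?z S))"
    by (rule ennreal_plus) simp_all
  also have "ennreal (1 / 2 * vnorm Linf (?z I - ?z S)) = ennreal (1 / 2) * ennreal (vnorm Linf (?z I - ?z S))"
    by (rule ennreal_mult) simp_all
  also have "ennreal (vnorm Linf (?x - ?z I)) + ennreal (1 / 2) * ennreal (vnorm Linf (?z I - ?z S))
      \<le> E + ennreal (1 / 2) * \<Delta> S"
    by (intro add_mono mult_left_mono E \<Delta> S(1)) simp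
  also have "\<dots> \<le> (MAX J\<in>sensor_sets m \<rho>. E + ennreal (1 / 2) * \<Delta> J)"
    using subsetD[OF valid_subset S(1)] by (intro Max_ge) auto
  finally show "ennreal \<bar>est_error G \<rho> K p Linf w a t $ i\<bar>
    \<le> (MAX J\<in>sensor_sets m \<rho>. E + ennreal (1 / 2) * \<Delta> J)" .
qed

text \<open>
  The estimate deviates from the local estimate \<open>I\<close> by the average of the differences between
  estimate \<open>I\<close> and the valid ones, and the set of the valid ones shrinks with time. The energy of this
  deviation is thus bounded by \<open>average_energy_le\<close>, where the set \<open>I\<close>, always valid and with
  difference zero, is the immortal member.
\<close>

lemma est_error_L2_le:
  assumes I: "\<And>t. I \<in> valid p L2 (measurement G w a) t"
    and E: "trunc_norm L2 T (\<lambda>t. lti_state G w t - local_est G K I (measurement G w a) t) \<le> E"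
    and \<Delta>: "\<And>J S. J \<in> valid p L2 (measurement G w a) S \<Longrightarrow>
      trunc_norm L2 S (\<lambda>t. local_est G K I (measurement G w a) t
        - local_est G K J (measurement G w a) t) \<le> \<Delta> J"
  shows "trunc_norm L2 T (est_error G \<rho> K p L2 w a)
    \<le> E + (MAX J\<in>sensor_sets m \<rho>. ennreal (sqrt (1 / 2 * ln (real (card (sensor_sets m \<rho>))))) * \<Delta> J)"
proof -
  let ?y = "measurement G w a"
  let ?V = "valid p L2 ?y" and ?z = "\<lambda>J. local_est G K J ?y" and ?x = "lti_state G w"
  let ?N = "card (sensor_sets m \<rho>)" and ?c = "sqrt (1 / 2 * ln (real (card (sensor_sets m \<rho>))))"
  define S where "S = sensor_sets m \<rho> - {I}"
  define \<delta> where "\<delta> J t i = ?z I t $ i - ?z J t $ i" for J t i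
  define energy where "energy J = (\<Sum>t\<in>{t. t \<le> T \<and> J \<in> ?V t}. \<Sum>i<n. (\<delta> J t i)\<^sup>2)" for J
  define d where "d = Max (insert 0 (energy ` S))"
  define g where "g t = vec n (\<lambda>i. (\<Sum>J\<in>{J \<in> S. J \<in> ?V t}. \<delta> J t i) / (1 + real (card {J \<in> S. J \<in> ?V t})))" for t
  have IV: "I \<in> sensor_sets m \<rho>" using I valid_subset by blast
  have finS: "finite S" by (simp add: S_def)
  have N: "?N = 1 + card S" unfolding S_def using card.remove[OF finite_sensor_sets IV] by simp
  have x: "?x t \<in> carrier_vec n" for t by (rule lti_state_carrier[OF lti_carrier_G])
  have z: "?z J t \<in> carrier_vec n" if "J \<in> sensor_sets m \<rho>" for J t
    by (rule local_est_carrier[OF that])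
  have split: "est_error G \<rho> K p L2 w a t = (?x t - ?z I t) + g t" for t
  proof (rule eq_vecI)
    fix i assume "i < dim_vec ((?x t - ?z I t) + g t)"
    then have i: "i < n" by (simp add: g_def)
    have V: "?V t = insert I {J \<in> S. J \<in> ?V t}" using I by (auto simp: S_def dest: subsetD[OF valid_subset])
    have nI: "I \<notin> {J \<in> S. J \<in> ?V t}" and fin: "finite {J \<in> S. J \<in> ?V t}"
      using finS by (auto simp: S_def)
    let ?k = "1 + real (card {J \<in> S. J \<in> ?V t})"
    have k: "real (card (?V t)) = ?k" using V nI fin by (metis card_insert_disjoint of_nat_Suc)
    have "(\<Sum>J\<in>?V t. ?z I t $ i - ?z J t $ i) = (\<Sum>J\<in>{J \<in> S. J \<in> ?V t}. \<delta> J t i)"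
      by (subst V, subst sum.insert[OF fin nI]) (simp add: \<delta>_def)
    then have "(\<Sum>J\<in>{J \<in> S. J \<in> ?V t}. \<delta> J t i) = ?k * ?z I t $ i - (\<Sum>J\<in>?V t. ?z J t $ i)"
      using k by (simp add: sum_subtractf)
    moreover have "0 < ?k" by simp
    ultimately have "(\<Sum>J\<in>{J \<in> S. J \<in> ?V t}. \<delta> J t i) / ?k = ?z I t $ i - (\<Sum>J\<in>?V t. ?z J t $ i) / ?k"
      by (simp add: diff_divide_distrib)
    then show "est_error G \<rho> K p L2 w a t $ i = ((?x t - ?z I t) + g t) $ i"
      using i x z[OF IV, of t] k by (simp add: est_error_def global_est_def Let_def g_def)
  qed (simp add: est_error_def global_est_def g_def Let_def)
  have "energy J \<le> d" if "J \<in> S" for J unfolding d_def using finS that by (intro Max_ge) auto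
  then have "(\<Sum>t\<le>T. \<Sum>i<n. ((\<Sum>J\<in>{J \<in> S. J \<in> ?V t}. \<delta> J t i) / (1 + real (card {J \<in> S. J \<in> ?V t})))\<^sup>2)
      \<le> ln (1 + real (card S)) / 2 * d"
    unfolding energy_def by (intro average_energy_le[OF finS]) (auto intro: valid_antimono)
  then have "(\<Sum>t\<le>T. \<Sum>i<n. (g t $ i)\<^sup>2) \<le> 1 / 2 * ln (real ?N) * d"
    by (simp add: g_def N)
  then have "sqrt (\<Sum>t\<le>T. \<Sum>i<n. (g t $ i)\<^sup>2) \<le> ?c * sqrt d"
    by (simp flip: real_sqrt_mult)
  then have "ennreal (sqrt (\<Sum>t\<le>T. \<Sum>i<n. (g t $ i)\<^sup>2)) \<le> ennreal (?c * sqrt d)"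
    by (rule ennreal_leI)
  moreover have "trunc_norm L2 T g = ennreal (sqrt (\<Sum>t\<le>T. \<Sum>i<n. (g t $ i)\<^sup>2))"
    by (rule trunc_norm_L2_eq) (simp add: g_def)
  moreover have "0 \<le> d" unfolding d_def using finS by (intro Max_ge) auto
  then have "ennreal (?c * sqrt d) = ennreal ?c * ennreal (sqrt d)"
    using N by (intro ennreal_mult) auto
  ultimately have g: "trunc_norm L2 T g \<le> ennreal ?c * ennreal (sqrt d)" by order
  have energy_le: "ennreal (sqrt (energy J)) \<le> \<Delta> J" if J: "J \<in> S" for J
  proof (cases "{t. t \<le> T \<and> J \<in> ?V t} = {}")
    case True
    then show ?thesis unfolding energy_def by (simp only: sum.empty) simp
  next
    case False
    \<comment> \<open>The last time at which \<open>J\<close> is valid: the hypothesis on the disagreement is only available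
      for truncations to such times.\<close>
    define S' where "S' = Max {t. t \<le> T \<and> J \<in> ?V t}"
    have fin: "finite {t. t \<le> T \<and> J \<in> ?V t}" by simp
    have S': "S' \<le> T" "J \<in> ?V S'" using Max_in[OF fin False] by (auto simp: S'_def)
    have "{t. t \<le> T \<and> J \<in> ?V t} = {..S'}"
    proof
      show "{t. t \<le> T \<and> J \<in> ?V t} \<subseteq> {..S'}" unfolding S'_def using Max_ge[OF fin] by auto
      show "{..S'} \<subseteq> {t. t \<le> T \<and> J \<in> ?V t}" using S' by (auto intro: valid_antimono)
    qed
    moreover have "\<delta> J t i = (?z I t - ?z J t) $ i" if "i < n" for t i
      using carrier_vecD[OF z[of J t]] J that by (simp add: S_def \<delta>_def)
    ultimately have "energy J = (\<Sum>t\<le>S'. \<Sum>i<n. ((?z I t - ?z J t) $ i)\<^sup>2)"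
      unfolding energy_def by (intro sum.cong) auto
    then have "ennreal (sqrt (energy J)) = trunc_norm L2 S' (\<lambda>t. ?z I t - ?z J t)"
      using z[of J] z[of I] IV J by (subst trunc_norm_L2_eq[of _ n]) (auto simp: S_def)
    then show ?thesis using \<Delta>[OF S'(2)] by simp
  qed
  have "d \<in> insert 0 (energy ` S)" unfolding d_def using finS by (intro Max_in) auto
  then have "ennreal ?c * ennreal (sqrt d) \<le> (MAX J\<in>sensor_sets m \<rho>. ennreal ?c * \<Delta> J)"
  proof
    assume "d \<in> energy ` S"
    then obtain J where J: "J \<in> S" "d = energy J" by blast
    then have "ennreal ?c * ennreal (sqrt d) \<le> ennreal ?c * \<Delta> J"
      using energy_le by (auto intro: mult_left_mono)
    also have "\<dots> \<le> (MAX J\<in>sensor_sets m \<rho>. ennreal ?c * \<Delta> J)"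
      using J by (intro Max_ge) (auto simp: S_def)
    finally show ?thesis .
  qed simp
  then have "trunc_norm L2 T g \<le> (MAX J\<in>sensor_sets m \<rho>. ennreal ?c * \<Delta> J)" using g by order
  moreover have "trunc_norm L2 T (est_error G \<rho> K p L2 w a)
      \<le> trunc_norm L2 T (\<lambda>t. ?x t - ?z I t) + trunc_norm L2 T g"
    unfolding split[abs_def] using x z[OF IV] by (intro trunc_norm_add_le[of _ n]) (auto simp: g_def)
  ultimately show ?thesis using E by (meson add_mono order_trans)
qed

lemma exists_unattacked:
  assumes a: "a \<in> signals m" "supp_size a \<le> \<rho>"
  obtains I where "I \<in> sensor_sets m \<rho>" and "\<And>t. sel m I *\<^sub>v a t = 0\<^sub>v (m - \<rho>)"
proof -
  define W where "W = {i. \<exists>t. i < dim_vec (a t) \<and> a t $ i \<noteq> 0}"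
  have dim: "dim_vec (a t) = m" for t using a(1) by (auto simp: signals_def)
  have W: "W \<subseteq> {0..<m}" by (auto simp: W_def dim)
  have "m - \<rho> \<le> card ({0..<m} - W)"
    using a(2) W card_Diff_subset[OF finite_subset[OF W] W] by (simp add: supp_size_def W_def)
  then obtain I where I: "I \<subseteq> {0..<m} - W" "card I = m - \<rho>" by (rule obtain_subset_with_card_n)
  have "sel m I *\<^sub>v a t = 0\<^sub>v (card I)" for t
    using I(1) dim by (intro sel_mult_vec_eq_0 carrier_vecI) (auto simp: W_def)
  then show ?thesis using I by (intro that[of I]) (auto simp: sensor_sets_def)
qed

lemma unattacked_valid:
  assumes I: "I \<in> sensor_sets m \<rho>" and w: "w \<in> signals l" "signal_norm p w \<le> 1" and a: "a \<in> signals m"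
    and unattacked: "\<And>t. sel m I *\<^sub>v a t = 0\<^sub>v (m - \<rho>)"
  shows "I \<in> valid p q (measurement G w a) t"
    and "signal_norm q (\<lambda>t. lti_state G w t - local_est G K I (measurement G w a) t) \<le> gain p q (sysE G K I)"
proof -
  have fin: "signal_norm p w < \<infinity>" by (rule le_less_trans[OF w(2)]) simp
  have le: "signal_norm q (lti_output H w) \<le> gain p q H" if "lti_carrier n l k H" for H k
    using signal_norm_lti_output_le[OF that w(1) fin, of q] mult_left_mono[OF w(2), of "gain p q H"]
    by (simp del: signal_norm.simps)
  have "residual G K I (measurement G w a) = lti_output (sysF G K I) w"
    using unattacked_estimator(2)[OF I w(1) a unattacked] by blast
  then show "I \<in> valid p q (measurement G w a) t"
    using I order_trans[OF trunc_norm_le_signal_norm le[OF lti_carrier_sysF[OF I]]]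
    by (simp add: valid_sets_def)
  have "(\<lambda>t. lti_state G w t - local_est G K I (measurement G w a) t) = lti_output (sysE G K I) w"
    using unattacked_estimator(1)[OF I w(1) a unattacked] by blast
  then show "signal_norm q (\<lambda>t. lti_state G w t - local_est G K I (measurement G w a) t) \<le> gain p q (sysE G K I)"
    using le[OF lti_carrier_sysE[OF I]] by (simp del: signal_norm.simps)
qed

text \<open>
  The bound is stated for an arbitrary bound \<open>\<Delta>\<close> on the disagreement of simultaneously valid
  estimators, because it is used twice: with the discrepancy, and with a finite \<open>\<Delta>\<close> in order to
  see that the error is bounded.
\<close>

lemma worst_case_error_le:
  assumes \<Delta>: "\<And>w a T I J. (w, a) \<in> admissible G \<rho> p \<Longrightarrow>
      I \<in> valid p q (measurement G w a) T \<Longrightarrow> J \<in> valid p q (measurement G w a) T \<Longrightarrow>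
      trunc_norm q T (\<lambda>t. local_est G K I (measurement G w a) t
        - local_est G K J (measurement G w a) t) \<le> \<Delta> I J"
  shows "worst_case_error G \<rho> K p q \<le> (if q = L2 then
      (MAX I\<in>sensor_sets m \<rho>. gain p q (sysE G K I)) +
      (MAX (I, J)\<in>sensor_sets m \<rho> \<times> sensor_sets m \<rho>.
        ennreal (sqrt (1 / 2 * ln (real (card (sensor_sets m \<rho>))))) * \<Delta> I J)
    else (MAX (I, J)\<in>sensor_sets m \<rho> \<times> sensor_sets m \<rho>. gain p q (sysE G K I) + ennreal (1 / 2) * \<Delta> I J))"
    (is "_ \<le> ?bound")
proof -
  let ?V = "sensor_sets m \<rho>" and ?E = "\<lambda>I. gain p q (sysE G K I)"
  let ?c = "ennreal (sqrt (1 / 2 * ln (real (card (sensor_sets m \<rho>)))))"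
  have row: "(MAX J\<in>?V. f I J) \<le> (MAX (I, J)\<in>?V \<times> ?V. f I J)" if "I \<in> ?V" for f :: "nat set \<Rightarrow> nat set \<Rightarrow> ennreal" and I
    using that by (intro Max_mono) (auto simp: image_def)
  have "signal_norm q (est_error G \<rho> K p q w a) \<le> ?bound" if adm: "(w, a) \<in> admissible G \<rho> p" for w a
  proof -
    let ?y = "measurement G w a"
    have w: "w \<in> signals l" "signal_norm p w \<le> 1" and a: "a \<in> signals m" "supp_size a \<le> \<rho>"
      using adm by (auto simp: admissible_def)
    obtain I where I: "I \<in> ?V" and clean: "\<And>t. sel m I *\<^sub>v a t = 0\<^sub>v (m - \<rho>)"
      using exists_unattacked[OF a] by blast
    note val = unattacked_valid(1)[OF I w a(1) clean] and E = unattacked_valid(2)[OF I w a(1) clean]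
    show ?thesis
    proof (cases q)
      case L2
      have "signal_norm L2 (est_error G \<rho> K p L2 w a)
          \<le> (MAX I\<in>?V. ?E I) + (MAX (I, J)\<in>?V \<times> ?V. ?c * \<Delta> I J)"
      proof (rule signal_norm_le_trunc)
        fix T
        have "trunc_norm L2 T (est_error G \<rho> K p L2 w a) \<le> ?E I + (MAX J\<in>?V. ?c * \<Delta> I J)"
        proof (rule est_error_L2_le)
          show "I \<in> valid p L2 ?y t" for t by (rule val)
          show "trunc_norm L2 T (\<lambda>t. lti_state G w t - local_est G K I ?y t) \<le> ?E I"
            using order_trans[OF trunc_norm_le_signal_norm E] L2 by blast
          show "trunc_norm L2 S (\<lambda>t. local_est G K I ?y t - local_est G K J ?y t) \<le> \<Delta> I J"
            if "J \<in> valid p L2 ?y S" for J S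
            using \<Delta>[OF adm] val that L2 by blast
        qed
        also have "\<dots> \<le> (MAX I\<in>?V. ?E I) + (MAX (I, J)\<in>?V \<times> ?V. ?c * \<Delta> I J)"
          using I by (intro add_mono row Max_ge) auto
        finally show "trunc_norm L2 T (est_error G \<rho> K p L2 w a)
          \<le> (MAX I\<in>?V. ?E I) + (MAX (I, J)\<in>?V \<times> ?V. ?c * \<Delta> I J)" .
      qed
      then show ?thesis by (simp only: L2 refl if_True)
    next
      case Linf
      have "ennreal (vnorm Linf (est_error G \<rho> K p Linf w a t)) \<le> (MAX (I, J)\<in>?V \<times> ?V. ?E I + ennreal (1 / 2) * \<Delta> I J)" for t
      proof -
        have "ennreal (vnorm Linf (est_error G \<rho> K p Linf w a t)) \<le> (MAX J\<in>?V. ?E I + ennreal (1 / 2) * \<Delta> I J)"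
        proof (rule est_error_Linf_le)
          show "I \<in> valid p Linf ?y t" by (rule val)
          show "ennreal (vnorm Linf (lti_state G w t - local_est G K I ?y t)) \<le> ?E I"
            using vnorm_le_trunc_norm[of Linf "\<lambda>t. lti_state G w t - local_est G K I ?y t" t]
              trunc_norm_le_signal_norm[of Linf t "\<lambda>t. lti_state G w t - local_est G K I ?y t"] E
            unfolding Linf by (meson order_trans)
          show "ennreal (vnorm Linf (local_est G K I ?y t - local_est G K J ?y t)) \<le> \<Delta> I J"
            if "J \<in> valid p Linf ?y t" for J
            using vnorm_le_trunc_norm[of Linf "\<lambda>t. local_est G K I ?y t - local_est G K J ?y t" t]
              \<Delta>[OF adm, of I t J] val that Linf by (meson order_trans)
        qed
        also have "\<dots> \<le> (MAX (I, J)\<in>?V \<times> ?V. ?E I + ennreal (1 / 2) * \<Delta> I J)" by (rule row[OF I])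
        finally show ?thesis .
      qed
      then show ?thesis using Linf by (auto intro!: SUP_least simp del: vnorm.simps)
    qed
  qed
  then show ?thesis unfolding worst_case_error_def by (intro SUP_least) auto
qed

text \<open>
  The intermediate norm \<open>r\<close> is free: \<open>r = p\<close> leads to the discrepancy, and \<open>r = q\<close> to a
  bound by the gains that define validity.
\<close>

lemma trunc_norm_disagreement_le:
  fixes r :: lp
  assumes I: "I \<in> sensor_sets m \<rho>" and J: "J \<in> sensor_sets m \<rho>"
    and L: "L \<in> carrier_mat n (card (I \<inter> J))" and y: "\<And>t. y t \<in> carrier_vec m"
  shows "trunc_norm q T (\<lambda>t. local_est G K I y t - local_est G K J y t)
    \<le> gain r q (disagreement_system (I \<inter> J) L) *
      (mat_norm r (injection (I \<inter> J) I) * trunc_norm r T (residual G K I y)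
       + mat_norm r (injection (I \<inter> J) J) * trunc_norm r T (residual G K J y))"
proof -
  let ?v = "\<lambda>S t. injection (I \<inter> J) S *\<^sub>v residual G K S y t"
  have inj: "injection (I \<inter> J) I \<in> carrier_mat (n + card (I \<inter> J)) (m - \<rho>)"
    "injection (I \<inter> J) J \<in> carrier_mat (n + card (I \<inter> J)) (m - \<rho>)"
    using injection_carrier[OF I] injection_carrier[OF J] by auto
  have v: "?v I t \<in> carrier_vec (n + card (I \<inter> J))" "?v J t \<in> carrier_vec (n + card (I \<inter> J))" for t
    by (rule mult_mat_vec_carrier[OF inj(1) residual_carrier[OF I]]
      mult_mat_vec_carrier[OF inj(2) residual_carrier[OF J]])+
  have "trunc_norm q T (\<lambda>t. local_est G K I y t - local_est G K J y t)
      = trunc_norm q T (lti_output (disagreement_system (I \<inter> J) L) (\<lambda>t. ?v I t - ?v J t))"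
    by (intro trunc_norm_cong local_est_disagreement[OF I J L y])
  also have "\<dots> \<le> gain r q (disagreement_system (I \<inter> J) L) * trunc_norm r T (\<lambda>t. ?v I t - ?v J t)"
    using v sensor_setD(2)[OF I] by (intro trunc_norm_lti_output_le[OF lti_carrier_disagreement_system[OF _ L]]) auto
  also have "trunc_norm r T (\<lambda>t. ?v I t - ?v J t) \<le> trunc_norm r T (?v I) + trunc_norm r T (?v J)"
    using v by (rule trunc_norm_diff_le)
  also have "\<dots> \<le> mat_norm r (injection (I \<inter> J) I) * trunc_norm r T (residual G K I y)
       + mat_norm r (injection (I \<inter> J) J) * trunc_norm r T (residual G K J y)"
    using carrier_matD(2)[OF inj(1)] carrier_matD(2)[OF inj(2)] residual_carrier[OF I] residual_carrier[OF J]
    by (intro add_mono trunc_norm_mult_mat_le) auto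
  finally show ?thesis by (simp add: mult_left_mono del: trunc_norm.simps)
qed

lemma trunc_norm_disagreement_le_discrepancy:
  assumes adm: "(w, a) \<in> admissible G \<rho> p"
    and I: "I \<in> valid p q (measurement G w a) T" and J: "J \<in> valid p q (measurement G w a) T"
  shows "trunc_norm q T (\<lambda>t. local_est G K I (measurement G w a) t - local_est G K J (measurement G w a) t)
    \<le> discrepancy G \<rho> K p q I J"
proof -
  let ?y = "measurement G w a" and ?Q = "I \<inter> J"
  let ?\<delta> = "trunc_norm q T (\<lambda>t. local_est G K I (measurement G w a) t - local_est G K J (measurement G w a) t)"
  let ?b = "\<lambda>S. mat_norm p (injection (I \<inter> J) S) * trunc_norm p T (residual G K S (measurement G w a))"
  have IV: "I \<in> sensor_sets m \<rho>" and JV: "J \<in> sensor_sets m \<rho>" using I J valid_subset by blast+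
  have y: "?y t \<in> carrier_vec m" for t
    using adm by (intro measurement_carrier) (auto simp: admissible_def)
  have matA_G: "matA G = A" by (simp add: G)
  have beta: "?b S \<le> beta G \<rho> K p q S ?Q" if "S \<in> valid p q ?y T" for S
  proof -
    have "trunc_norm p T (residual G K S ?y) \<le> (SUP (w, a, T)\<in>{(w, a, T). (w, a) \<in> admissible G \<rho> p
        \<and> S \<in> valid p q (measurement G w a) T}. trunc_norm p T (residual G K S (measurement G w a)))"
      using adm that by (intro SUP_upper2[where i = "(w, a, T)"]) (auto simp del: trunc_norm.simps)
    then show ?thesis by (auto simp: beta_def injection_def intro!: mult_left_mono)
  qed
  have bounded: "?b I + ?b J < \<infinity>"
    using mat_norm_finite by (auto simp: trunc_norm_eq_time_norm ennreal_mult_less_top less_top)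
  \<comment> \<open>The infimum in \<open>alpha\<close> is taken while the residuals are fixed, hence for a finite factor;
    only afterwards are their norms replaced by the suprema in \<open>beta\<close>, which may be infinite.\<close>
  have "?\<delta> \<le> alpha G p q ?Q * (?b I + ?b J)"
  proof (cases "?b I + ?b J = 0")
    case True
    obtain L :: "real mat" where L: "L \<in> carrier_mat n (card ?Q)" using exists_common_gain[OF IV JV] by blast
    then show ?thesis using trunc_norm_disagreement_le[where y = ?y and q = q and T = T and r = p, OF IV JV L y] unfolding True by simp
  next
    case False
    have "?\<delta> / (?b I + ?b J) \<le> alpha G p q ?Q"
      unfolding alpha_def Let_def
    proof (rule INF_greatest)
      fix L assume "L \<in> {L \<in> carrier_mat (state_dim G) (card ?Q). strictly_stable (matA G + L * selC G ?Q)}"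
      then have L: "L \<in> carrier_mat n (card ?Q)" by simp
      have "?\<delta> / (?b I + ?b J) \<le> gain p q (disagreement_system ?Q L)"
        using trunc_norm_disagreement_le[where y = ?y and q = q and T = T and r = p, OF IV JV L y] False
        by (intro divide_le_posI_ennreal) (auto simp: zero_less_iff_neq_zero mult.commute simp del: trunc_norm.simps)
      then show "?\<delta> / (?b I + ?b J) \<le> gain p q (LTI (matA G + L * selC G ?Q) (append_cols (1\<^sub>m (state_dim G)) L)
          (1\<^sub>m (state_dim G)) (0\<^sub>m (state_dim G) (state_dim G + card ?Q)))"
        by (simp add: disagreement_system_def matA_G carrier_matD(1)[OF A] del: trunc_norm.simps)
    qed
    then have "?\<delta> / (?b I + ?b J) * (?b I + ?b J) \<le> alpha G p q ?Q * (?b I + ?b J)"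
      by (rule mult_right_mono) simp
    moreover have "?\<delta> / (?b I + ?b J) * (?b I + ?b J) = ?\<delta>"
      using False bounded by (intro ennreal_divide_times[THEN trans]) (simp add: ennreal_divide_self del: trunc_norm.simps)
    ultimately show ?thesis by simp
  qed
  also have "\<dots> \<le> discrepancy G \<rho> K p q I J"
    unfolding discrepancy_def by (intro mult_left_mono add_mono beta I J) simp
  finally show ?thesis .
qed

text \<open>
  The discrepancy can be infinite for \<open>(L2, Linf)\<close>, since a residual that is bounded in \<open>Linf\<close>
  may have unbounded energy. Validity bounds the residuals in the norm \<open>q\<close>, and stable systems also
  have a finite gain from \<open>q\<close> to \<open>q\<close>; this gives a finite bound in all cases.
\<close>

lemma finite_disagreement_bound:
  assumes gainF: "\<And>I. I \<in> sensor_sets m \<rho> \<Longrightarrow> gain p q (sysF G K I) < \<infinity>"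
  obtains \<Delta> where "\<And>I J. I \<in> sensor_sets m \<rho> \<Longrightarrow> J \<in> sensor_sets m \<rho> \<Longrightarrow> \<Delta> I J < \<infinity>"
    and "\<And>w a T I J. (w, a) \<in> admissible G \<rho> p \<Longrightarrow>
      I \<in> valid p q (measurement G w a) T \<Longrightarrow> J \<in> valid p q (measurement G w a) T \<Longrightarrow>
      trunc_norm q T (\<lambda>t. local_est G K I (measurement G w a) t
        - local_est G K J (measurement G w a) t) \<le> \<Delta> I J"
proof -
  have "\<exists>L. I \<in> sensor_sets m \<rho> \<longrightarrow> J \<in> sensor_sets m \<rho> \<longrightarrow>
      L \<in> carrier_mat n (card (I \<inter> J)) \<and> strictly_stable (A + L * selC G (I \<inter> J))" for I J
    using exists_common_gain by metis
  then obtain L where L: "\<And>I J. I \<in> sensor_sets m \<rho> \<Longrightarrow> J \<in> sensor_sets m \<rho> \<Longrightarrow>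
      L I J \<in> carrier_mat n (card (I \<inter> J)) \<and> strictly_stable (A + L I J * selC G (I \<inter> J))" by metis
  define \<Delta> where "\<Delta> I J = gain q q (disagreement_system (I \<inter> J) (L I J)) *
      (mat_norm q (injection (I \<inter> J) I) * gain p q (sysF G K I)
       + mat_norm q (injection (I \<inter> J) J) * gain p q (sysF G K J))" for I J
  show ?thesis
  proof (rule that[of \<Delta>])
    fix I J assume I: "I \<in> sensor_sets m \<rho>" and J: "J \<in> sensor_sets m \<rho>"
    have "gain q q (disagreement_system (I \<inter> J) (L I J)) < \<infinity>"
      using L[OF I J] sensor_setD(2)[OF I]
      by (intro gain_finite_if_strictly_stable[OF lti_carrier_disagreement_system]) (auto simp: disagreement_system_def)
    then show "\<Delta> I J < \<infinity>"
      using gainF[OF I] gainF[OF J] mat_norm_finite by (auto simp: \<Delta>_def ennreal_mult_less_top)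
  next
    fix w a T I J
    assume adm: "(w, a) \<in> admissible G \<rho> p"
      and I: "I \<in> valid p q (measurement G w a) T" and J: "J \<in> valid p q (measurement G w a) T"
    have IV: "I \<in> sensor_sets m \<rho>" and JV: "J \<in> sensor_sets m \<rho>" using I J valid_subset by blast+
    have y: "measurement G w a t \<in> carrier_vec m" for t
      using adm by (intro measurement_carrier) (auto simp: admissible_def)
    have "trunc_norm q T (residual G K I (measurement G w a)) \<le> gain p q (sysF G K I)"
      and "trunc_norm q T (residual G K J (measurement G w a)) \<le> gain p q (sysF G K J)"
      using I J by (auto simp: valid_sets_def)
    then have "gain q q (disagreement_system (I \<inter> J) (L I J)) *
        (mat_norm q (injection (I \<inter> J) I) * trunc_norm q T (residual G K I (measurement G w a))
         + mat_norm q (injection (I \<inter> J) J) * trunc_norm q T (residual G K J (measurement G w a))) \<le> \<Delta> I J"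
      unfolding \<Delta>_def by (intro mult_left_mono add_mono) auto
    moreover have "L I J \<in> carrier_mat n (card (I \<inter> J))" using L[OF IV JV] by blast
    ultimately show "trunc_norm q T (\<lambda>t. local_est G K I (measurement G w a) t
        - local_est G K J (measurement G w a) t) \<le> \<Delta> I J"
      using trunc_norm_disagreement_le[where y = "measurement G w a" and q = q and T = T and r = q, OF IV JV _ y]
      by (meson order_trans)
  qed
qed

lemma gain_finite:
  assumes "(p, q) \<in> {(L2, L2), (L2, Linf), (Linf, Linf)}"
    and "lti_carrier n l' k H" and "strictly_stable (matA H)"
  shows "gain p q H < \<infinity>"
  using assms(1) gain_finite_if_strictly_stable[OF assms(2,3)] le_less_trans[OF gain_L2_Linf_le_L2_L2] by auto

lemma worst_case_error_finite:
  assumes pq: "(p, q) \<in> {(L2, L2), (L2, Linf), (Linf, Linf)}"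
  shows "worst_case_error G \<rho> K p q < \<infinity>"
proof -
  let ?V = "sensor_sets m \<rho>"
  have F: "gain p q (sysF G K I) < \<infinity>" and E: "gain p q (sysE G K I) < \<infinity>" if "I \<in> ?V" for I
    using gain_finite[OF pq lti_carrier_sysF[OF that]] gain_finite[OF pq lti_carrier_sysE[OF that]] stable[OF that]
    by (auto simp: sysE_def sysF_def G)
  obtain \<Delta> where fin: "\<And>I J. I \<in> ?V \<Longrightarrow> J \<in> ?V \<Longrightarrow> \<Delta> I J < \<infinity>"
    and \<Delta>: "\<And>w a T I J. (w, a) \<in> admissible G \<rho> p \<Longrightarrow>
      I \<in> valid p q (measurement G w a) T \<Longrightarrow> J \<in> valid p q (measurement G w a) T \<Longrightarrow>
      trunc_norm q T (\<lambda>t. local_est G K I (measurement G w a) t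
        - local_est G K J (measurement G w a) t) \<le> \<Delta> I J"
    using finite_disagreement_bound[of p q, OF F] by blast
  obtain I where "I \<subseteq> {0..<m}" "card I = m - \<rho>"
    using obtain_subset_with_card_n[of "m - \<rho>" "{0..<m}"] by auto
  then have "?V \<noteq> {}" by (auto simp: sensor_sets_def)
  then show ?thesis
    using E fin ennreal_less_top[of "1 / 2"]
    by (intro le_less_trans[OF worst_case_error_le[of p q \<Delta>, OF \<Delta>]])
      (auto simp: ennreal_mult_less_top)
qed

end

theorem theorem2:
  fixes n l m \<rho> :: nat
    and A B C D :: "real mat"
    and G :: lti
    and V :: "nat set set"
    and K :: "nat set \<Rightarrow> real mat"
    and p q :: lp
  assumes "A \<in> carrier_mat n n" and "B \<in> carrier_mat n l"
    and "C \<in> carrier_mat m n" and "D \<in> carrier_mat m l"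
    and "vec_space.rank n B = n"
    and "G = LTI A B C D"
    and "V = sensor_sets m \<rho>"
    and "\<forall>I\<in>V. K I \<in> carrier_mat n (m - \<rho>) \<and> strictly_stable (A + K I * selC G I)"
    and "chi_detectable (2 * \<rho>) G"
    and "(p, q) \<in> {(L2, L2), (L2, Linf), (Linf, Linf)}"
  shows "worst_case_error G \<rho> K p q < \<infinity> \<and>
    worst_case_error G \<rho> K p q \<le>
      (if (p, q) = (L2, L2) then
         (MAX I\<in>V. gain L2 L2 (sysE G K I)) +
         (MAX (I, J)\<in>V \<times> V.
            ennreal (sqrt (1 / 2 * ln (real (card V)))) * discrepancy G \<rho> K L2 L2 I J)
       else if (p, q) = (L2, Linf) then
         (MAX (I, J)\<in>V \<times> V.
            gain L2 Linf (sysE G K I) + ennreal (1 / 2) * discrepancy G \<rho> K L2 Linf I J)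
       else
         (MAX (I, J)\<in>V \<times> V.
            gain Linf Linf (sysE G K I) + ennreal (1 / 2) * discrepancy G \<rho> K Linf Linf I J))"
proof -
  interpret observer_bank n l m \<rho> A B C D G K
    using assms by unfold_locales auto
  let ?V = "sensor_sets m \<rho>"
  have "worst_case_error G \<rho> K p q < \<infinity>" using assms(10) by (rule worst_case_error_finite)
  moreover note worst_case_error_le[of p q, OF trunc_norm_disagreement_le_discrepancy]
  ultimately show ?thesis using assms(7,10) by auto
qed

end
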